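(* Suppose $1\le n<\omega$, $\kappa$ is $\Pi^1_n$-indescribable and $\square_n(\kappa)$ holds. Then there are two $\Pi^1_n$-indescribable subsets $S_0,S_1\subseteq\kappa$ that do not reflect simultaneously, i.e., there is no $\beta<\kappa$ such that $S_0\cap\beta$ and $S_1\cap\beta$ are both $\Pi^1_n$-indescribable subsets of $\beta$.
   Context: For a cardinal $\kappa$ and $m<\omega$, $S\subseteq\kappa$ is $\Pi^1_m$-indescribable if for every $A\subseteq V_\kappa$ and every $\Pi^1_m$ sentence $\varphi$ with $(V_\kappa,\in,A)\models\varphi$ there is $\alpha\in S$ with $(V_\alpha,\in,A\cap V_\alpha)\models\varphi$; $\kappa$ is $\Pi^1_m$-indescribable if $\kappa$ is. $\Pi^1_m(\alpha)^+$ denotes the set of $\Pi^1_m$-indescribable subsets of $\alpha$. ${\rm Tr}_m(X)=\{\alpha<\kappa: X\cap\alpha\in\Pi^1_m(\alpha)^+\}$; in particular ${\rm Tr}_{m}(\kappa)$ is the set of $\Pi^1_m$-indescribable cardinals below $\kappa$. A set $X\subseteq\kappa$ is $n$-closed if whenever $\alpha<\kappa$ and $X\cap\alpha\in\Pi^1_{n-1}(\alpha)^+$, then $\alpha\in X$; it is $n$-club if it is $n$-closed and $\Pi^1_{n-1}$-indescribable. $\square_n(\kappa)$ asserts the existence of a sequence $\langle C_\alpha:\alpha\in{\rm Tr}_{n-1}(\kappa)\rangle$ (with ${\rm Tr}_{n-1}(\kappa)$ cofinal in $\kappa$) such that each $C_\alpha$ is an $n$-club subset of $\alpha$, for $\alpha<\beta$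 in ${\rm Tr}_{n-1}(\kappa)$, $C_\beta\cap\alpha\in\Pi^1_{n-1}(\alpha)^+$ implies $C_\alpha=C_\beta\cap\alpha$, and there is no thread: no $n$-club $C\subseteq\kappa$ such that $C_\alpha=C\cap\alpha$ for all $\alpha\in{\rm Tr}_{n-1}(\kappa)$ with $C\cap\alpha\in\Pi^1_{n-1}(\alpha)^+$. *)

theory Defs
  imports "HOL-Library.Equipollence"
begin

(* The ambient universe of sets: any type carrying the (second-order) ZF axioms.
   Choice is inherited from HOL. Separation and replacement range over all HOL predicates
   and functions, and foundation is well-foundedness of membership. *)
class zfc_universe =
  fixes elts :: "'a \<Rightarrow> 'a set"
  assumes extensionality: "elts x = elts y \<Longrightarrow> x = y"
    and foundation: "wf {(x, y). x \<in> elts y}"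
    and pairing: "\<exists>z. elts z = {x, y}"
    and union: "\<exists>y. elts y = (\<Union>z\<in>elts x. elts z)"
    and powerset: "\<exists>y. elts y = {z. elts z \<subseteq> elts x}"
    and separation: "\<exists>y. elts y = {z \<in> elts x. P z}"
    and replacement: "\<exists>y. elts y = f ` elts x"
    and infinity: "\<exists>x. (\<exists>z\<in>elts x. elts z = {}) \<and>
                       (\<forall>y\<in>elts x. \<exists>z\<in>elts x. elts z = insert y (elts y))"

(* Ordinals are von Neumann ordinals, so "\<alpha> < \<kappa>" is "\<alpha> \<in> elts \<kappa>", and a subset of \<kappa> is
   a HOL set S \<subseteq> elts \<kappa>; by separation every such S is the extension of an element of
   the universe. The same applies to subsets of V_\<kappa>. *)
definition trans_set :: "'v::zfc_universe \<Rightarrow> bool" where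
  "trans_set x \<longleftrightarrow> (\<forall>y\<in>elts x. elts y \<subseteq> elts x)"

definition ordinal :: "'v::zfc_universe \<Rightarrow> bool" where
  "ordinal \<alpha> \<longleftrightarrow> trans_set \<alpha> \<and> (\<forall>\<beta>\<in>elts \<alpha>. trans_set \<beta>)"

definition cardinal :: "'v::zfc_universe \<Rightarrow> bool" where
  "cardinal \<kappa> \<longleftrightarrow> ordinal \<kappa> \<and> (\<forall>\<alpha>\<in>elts \<kappa>. \<not> elts \<alpha> \<approx> elts \<kappa>)"

(* The level V_\<alpha> of the cumulative hierarchy; the equation also makes sense, but is not
   used, when \<alpha> is not an ordinal. *)
function Vlevel :: "'v::zfc_universe \<Rightarrow> 'v set" where
  "Vlevel \<alpha> = (\<Union>\<beta>\<in>elts \<alpha>. {x. elts x \<subseteq> Vlevel \<beta>})"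
  by pat_completeness auto
termination
  by (relation "{(x, y). x \<in> elts y}") (auto intro: foundation)

declare Vlevel.simps [simp del]

(* Second-order formulas in the language {\<in>, A}, with A a unary predicate symbol. The first-order
   and the (unary) second-order variables are two separate families, each indexed by nat;
   SMem x X says that the first-order variable x belongs to the second-order variable X. *)
datatype fm =
    Mem nat nat
  | Eq nat nat
  | InA nat
  | SMem nat nat
  | Neg fm
  | Conj fm fm
  | All nat fm
  | SAll nat fm
  | SEx nat fm

primrec free1 :: "fm \<Rightarrow> nat set" where
  "free1 (Mem x y) = {x, y}"
| "free1 (Eq x y) = {x, y}"
| "free1 (InA x) = {x}"
| "free1 (SMem x X) = {x}"
| "free1 (Neg \<phi>) = free1 \<phi>"
| "free1 (Conj \<phi> \<psi>) = free1 \<phi> \<union> free1 \<psi>"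
| "free1 (All x \<phi>) = free1 \<phi> - {x}"
| "free1 (SAll X \<phi>) = free1 \<phi>"
| "free1 (SEx X \<phi>) = free1 \<phi>"

primrec free2 :: "fm \<Rightarrow> nat set" where
  "free2 (Mem x y) = {}"
| "free2 (Eq x y) = {}"
| "free2 (InA x) = {}"
| "free2 (SMem x X) = {X}"
| "free2 (Neg \<phi>) = free2 \<phi>"
| "free2 (Conj \<phi> \<psi>) = free2 \<phi> \<union> free2 \<psi>"
| "free2 (All x \<phi>) = free2 \<phi>"
| "free2 (SAll X \<phi>) = free2 \<phi> - {X}"
| "free2 (SEx X \<phi>) = free2 \<phi> - {X}"

definition sentence :: "fm \<Rightarrow> bool" where
  "sentence \<phi> \<longleftrightarrow> free1 \<phi> = {} \<and> free2 \<phi> = {}"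

(* Full second-order semantics: second-order quantifiers range over all subsets of the domain M. *)
primrec sat ::
  "'v::zfc_universe set \<Rightarrow> 'v set \<Rightarrow> (nat \<Rightarrow> 'v) \<Rightarrow> (nat \<Rightarrow> 'v set) \<Rightarrow> fm \<Rightarrow> bool" where
  "sat M A s t (Mem x y) \<longleftrightarrow> s x \<in> elts (s y)"
| "sat M A s t (Eq x y) \<longleftrightarrow> s x = s y"
| "sat M A s t (InA x) \<longleftrightarrow> s x \<in> A"
| "sat M A s t (SMem x X) \<longleftrightarrow> s x \<in> t X"
| "sat M A s t (Neg \<phi>) \<longleftrightarrow> \<not> sat M A s t \<phi>"
| "sat M A s t (Conj \<phi> \<psi>) \<longleftrightarrow> sat M A s t \<phi> \<and> sat M A s t \<psi>"
| "sat M A s t (All x \<phi>) \<longleftrightarrow> (\<forall>a\<in>M. sat M A (s(x := a)) t \<phi>)"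
| "sat M A s t (SAll X \<phi>) \<longleftrightarrow> (\<forall>B. B \<subseteq> M \<longrightarrow> sat M A s (t(X := B)) \<phi>)"
| "sat M A s t (SEx X \<phi>) \<longleftrightarrow> (\<exists>B. B \<subseteq> M \<and> sat M A s (t(X := B)) \<phi>)"

(* (M, \<in>, A) \<Turnstile> \<phi>. It is only used for sentences, whose truth does not depend on the assignments.
   The assignments are not required to take values in M, so M = {} (that is, V_0) is no exception. *)
definition models :: "'v::zfc_universe set \<Rightarrow> 'v set \<Rightarrow> fm \<Rightarrow> bool" where
  "models M A \<phi> \<longleftrightarrow> (\<forall>s t. sat M A s t \<phi>)"

primrec first_order :: "fm \<Rightarrow> bool" where
  "first_order (Mem x y) \<longleftrightarrow> True"
| "first_order (Eq x y) \<longleftrightarrow> True"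
| "first_order (InA x) \<longleftrightarrow> True"
| "first_order (SMem x X) \<longleftrightarrow> True"
| "first_order (Neg \<phi>) \<longleftrightarrow> first_order \<phi>"
| "first_order (Conj \<phi> \<psi>) \<longleftrightarrow> first_order \<phi> \<and> first_order \<psi>"
| "first_order (All x \<phi>) \<longleftrightarrow> first_order \<phi>"
| "first_order (SAll X \<phi>) \<longleftrightarrow> False"
| "first_order (SEx X \<phi>) \<longleftrightarrow> False"

(* Pi1 m \<phi>: \<phi> is a prefix of m alternating, possibly empty, blocks of second-order quantifiers,
   the first block universal, followed by a formula without second-order quantifiers. *)
inductive Pi1 :: "nat \<Rightarrow> fm \<Rightarrow> bool" and Sigma1 :: "nat \<Rightarrow> fm \<Rightarrow> bool" where
  Pi1_0: "first_order \<phi> \<Longrightarrow> Pi1 0 \<phi>"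
| Sigma1_0: "first_order \<phi> \<Longrightarrow> Sigma1 0 \<phi>"
| Pi1_Suc: "Sigma1 m \<phi> \<Longrightarrow> Pi1 (Suc m) \<phi>"
| Sigma1_Suc: "Pi1 m \<phi> \<Longrightarrow> Sigma1 (Suc m) \<phi>"
| Pi1_SAll: "Pi1 (Suc m) \<phi> \<Longrightarrow> Pi1 (Suc m) (SAll X \<phi>)"
| Sigma1_SEx: "Sigma1 (Suc m) \<phi> \<Longrightarrow> Sigma1 (Suc m) (SEx X \<phi>)"

definition indescribable_subset :: "nat \<Rightarrow> 'v::zfc_universe \<Rightarrow> 'v set \<Rightarrow> bool" where
  "indescribable_subset m \<kappa> S \<longleftrightarrow>
     cardinal \<kappa> \<and> S \<subseteq> elts \<kappa> \<and>
     (\<forall>A \<phi>. A \<subseteq> Vlevel \<kappa> \<and> Pi1 m \<phi> \<and> sentence \<phi> \<and> models (Vlevel \<kappa>) A \<phi> \<longrightarrow>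
        (\<exists>\<alpha>\<in>S. models (Vlevel \<alpha>) (A \<inter> Vlevel \<alpha>) \<phi>))"

definition indescribable :: "nat \<Rightarrow> 'v::zfc_universe \<Rightarrow> bool" where
  "indescribable m \<kappa> \<longleftrightarrow> indescribable_subset m \<kappa> (elts \<kappa>)"

definition Tr :: "nat \<Rightarrow> 'v::zfc_universe \<Rightarrow> 'v set \<Rightarrow> 'v set" where
  "Tr m \<kappa> X = {\<alpha> \<in> elts \<kappa>. indescribable_subset m \<alpha> (X \<inter> elts \<alpha>)}"

(* The index n - 1 in n_closed, n_club and square is truncated subtraction on nat:
   these notions are only meant for n \<ge> 1. *)
definition n_closed :: "nat \<Rightarrow> 'v::zfc_universe \<Rightarrow> 'v set \<Rightarrow> bool" where
  "n_closed n \<kappa> X \<longleftrightarrow>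
     X \<subseteq> elts \<kappa> \<and>
     (\<forall>\<alpha>\<in>elts \<kappa>. indescribable_subset (n - 1) \<alpha> (X \<inter> elts \<alpha>) \<longrightarrow> \<alpha> \<in> X)"

definition n_club :: "nat \<Rightarrow> 'v::zfc_universe \<Rightarrow> 'v set \<Rightarrow> bool" where
  "n_club n \<kappa> X \<longleftrightarrow> n_closed n \<kappa> X \<and> indescribable_subset (n - 1) \<kappa> X"

definition cofinal_in :: "'v::zfc_universe set \<Rightarrow> 'v \<Rightarrow> bool" where
  "cofinal_in X \<kappa> \<longleftrightarrow> X \<subseteq> elts \<kappa> \<and> (\<forall>\<alpha>\<in>elts \<kappa>. \<exists>\<beta>\<in>X. \<alpha> \<in> elts \<beta> \<or> \<alpha> = \<beta>)"

definition is_thread :: "nat \<Rightarrow> 'v::zfc_universe \<Rightarrow> ('v \<Rightarrow> 'v set) \<Rightarrow> 'v set \<Rightarrow> bool" where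
  "is_thread n \<kappa> C D \<longleftrightarrow>
     n_club n \<kappa> D \<and>
     (\<forall>\<alpha>\<in>Tr (n - 1) \<kappa> (elts \<kappa>).
        indescribable_subset (n - 1) \<alpha> (D \<inter> elts \<alpha>) \<longrightarrow> C \<alpha> = D \<inter> elts \<alpha>)"

(* The sequence is a function C on the whole universe of which only the values
   on Tr (n - 1) \<kappa> (elts \<kappa>) matter. *)
definition square :: "nat \<Rightarrow> 'v::zfc_universe \<Rightarrow> bool" where
  "square n \<kappa> \<longleftrightarrow>
     cofinal_in (Tr (n - 1) \<kappa> (elts \<kappa>)) \<kappa> \<and>
     (\<exists>C :: 'v \<Rightarrow> 'v set.
        (\<forall>\<alpha>\<in>Tr (n - 1) \<kappa> (elts \<kappa>). n_club n \<alpha> (C \<alpha>)) \<and>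
        (\<forall>\<alpha>\<in>Tr (n - 1) \<kappa> (elts \<kappa>). \<forall>\<beta>\<in>Tr (n - 1) \<kappa> (elts \<kappa>).
           \<alpha> \<in> elts \<beta> \<and> indescribable_subset (n - 1) \<alpha> (C \<beta> \<inter> elts \<alpha>) \<longrightarrow>
             C \<alpha> = C \<beta> \<inter> elts \<alpha>) \<and>
        \<not> (\<exists>D. is_thread n \<kappa> C D))"

end

theory Submission
  imports Defs "HOL-Library.Countable"
begin

text \<open>For $\gamma < \kappa$ let $S_0$ and $S_1$ consist of the $\beta$ in
  ${\rm Tr}_{n-1}(\kappa)$ with $\gamma \in C_\beta$ and $\gamma \notin C_\beta$, respectively.
  If both reflect at $\delta$, then $C_\delta \cap \beta$ is $\Pi^1_{n-1}$-indescribable for some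
  $\beta > \gamma$ in each of them, and coherence makes $\gamma \in C_\delta$ both true and false. If
  for every $\gamma$ one of the two sets is not $\Pi^1_n$-indescribable, then normality of the
  $\Pi^1_n$-indescribability filter glues the measure-one values to a set $D$ with
  $C_\beta = D \cap \beta$ for almost all $\beta$, and $D$ is a thread.

  Normality, and the fact that $\Pi^1_{n-1}$-indescribability of a set reflects, need a universal
  $\Pi^1_n$ formula. No syntax is coded for it: at a level $V_\beta$ where every function has a
  closure point $V_\alpha$, a first-order statement holds iff it holds at all $V_\alpha$ closed under
  some function, iff it holds at some $V_\alpha$ closed under any given function. The truth values at
  levels below $\beta$ are handed to the formula as its predicate parameter.\<close>

text \<open>The formula must have no more quantifier blocks than the statement it expresses, yet the
  function under which a level is closed is an extra second-order variable. Having both a universal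
  and an existential form lets its quantifier be of the same kind as the innermost block and merge
  with it; hence the case split on the parity of \<open>k\<close>. The second obstacle is that these
  forms are equivalent only at levels with enough closure points, whereas a level found by
  reflection is arbitrary. So the formula itself asserts that there are closure points, by testing
  the set chosen in the first, universal, move. Winning conditions are HOL predicates subject to
  \<open>reflective\<close> and not formulas. They can thus be chosen separately for every \<gamma>,
  combined, and may refer to the truth of second-order sentences at smaller levels. Indescribability
  is reflected sentence by sentence: there are countably many sentences, and normality gives
  countable completeness.\<close>

section \<open>Sets, pairs, numerals and ordinals in the universe\<close>

lemma mem_irrefl: "x \<notin> elts (x::'v::zfc_universe)"
  using wf_not_refl[OF foundation] by auto

lemma mem_induct [case_names step]:
  "(\<And>x. (\<And>y. y \<in> elts x \<Longrightarrow> P y) \<Longrightarrow> P x) \<Longrightarrow> P (a::'v::zfc_universe)"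
  using wf_induct_rule[OF foundation, of P a] by auto

lemma mem_asym: "x \<in> elts y \<Longrightarrow> y \<notin> elts (x::'v::zfc_universe)"
  using wf_not_sym[OF foundation] by auto

text \<open>The class axioms only assert that sets exist; choice turns them into terms. The value is
  arbitrary if no set has the extension \<open>X\<close>, so \<open>elts_mk_set\<close> asks for a
  set that includes \<open>X\<close>.\<close>

definition mk_set :: "'v::zfc_universe set \<Rightarrow> 'v" where
  "mk_set X = (SOME z. elts z = X)"

lemma elts_mk_set_eq: "elts a = X \<Longrightarrow> elts (mk_set X) = X"
  unfolding mk_set_def by (rule someI)

lemma elts_mk_set: "X \<subseteq> elts a \<Longrightarrow> elts (mk_set X) = X"
proof -
  assume X: "X \<subseteq> elts a"
  obtain y where "elts y = {z \<in> elts a. z \<in> X}"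
    using separation[of a "\<lambda>z. z \<in> X"] by auto
  then have "elts y = X" using X by auto
  then show ?thesis by (rule elts_mk_set_eq)
qed

definition upair :: "'v::zfc_universe \<Rightarrow> 'v \<Rightarrow> 'v" where
  "upair x y = mk_set {x, y}"

lemma elts_upair [simp]: "elts (upair x y) = {x, y}"
  unfolding upair_def by (rule exE[OF pairing[of x y]]) (rule elts_mk_set_eq)

lemma upair_eq_iff: "z = upair x y \<longleftrightarrow> elts z = {x, y}"
  using extensionality[of z "upair x y"] by auto

definition kpair :: "'v::zfc_universe \<Rightarrow> 'v \<Rightarrow> 'v" where
  "kpair x y = upair (upair x x) (upair x y)"

lemma kpair_inject [simp]: "kpair x y = kpair x' y' \<longleftrightarrow> x = x' \<and> y = y'"
  unfolding kpair_def by (auto simp: upair_eq_iff doubleton_eq_iff)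

text \<open>Zermelo numerals, with {x} as the successor of x. They serve as tags and not as
  ordinals, and the singleton successor keeps \<open>fNum\<close> short.\<close>

primrec vnum :: "nat \<Rightarrow> 'v::zfc_universe" where
  "vnum 0 = mk_set {}"
| "vnum (Suc i) = upair (vnum i) (vnum i)"

lemma elts_vnum_0 [simp]: "elts (mk_set {}) = {}"
  by (rule elts_mk_set) auto

lemma vnum_inject [simp]: "vnum i = (vnum j :: 'v::zfc_universe) \<longleftrightarrow> i = j"
proof (induction i arbitrary: j)
  case 0
  have "vnum 0 \<noteq> (vnum (Suc k) :: 'v)" for k
    using elts_vnum_0 elts_upair by (metis insert_not_empty vnum.simps)
  then show ?case by (cases j) auto
next
  case (Suc i)
  show ?case
  proof (cases j)
    case 0
    then show ?thesis using elts_vnum_0 elts_upair by (metis insert_not_empty vnum.simps nat.distinct(1))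
  next
    case (Suc k)
    then show ?thesis using Suc.IH[of k] by (auto simp: upair_eq_iff)
  qed
qed

lemma ordinal_mem: "ordinal \<beta> \<Longrightarrow> \<alpha> \<in> elts \<beta> \<Longrightarrow> ordinal \<alpha>"
  unfolding ordinal_def trans_set_def by blast

lemma ordinal_trans: "ordinal \<gamma> \<Longrightarrow> \<alpha> \<in> elts \<beta> \<Longrightarrow> \<beta> \<in> elts \<gamma> \<Longrightarrow> \<alpha> \<in> elts \<gamma>"
  unfolding ordinal_def trans_set_def by blast

lemma ordinal_linear:
  fixes \<alpha> \<beta> :: "'v::zfc_universe"
  shows "ordinal \<alpha> \<Longrightarrow> ordinal \<beta> \<Longrightarrow> \<alpha> \<in> elts \<beta> \<or> \<alpha> = \<beta> \<or> \<beta> \<in> elts \<alpha>"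
proof (induction \<alpha> arbitrary: \<beta> rule: mem_induct)
  case (step \<alpha>)
  note IH = step(1) and oa = step(2)
  show ?case using step(3)
  proof (induction \<beta> rule: mem_induct)
    case (step \<beta>)
    show ?case
    proof (rule ccontr)
      assume n: "\<not> ?case"
      have "x \<in> elts \<beta>" if x: "x \<in> elts \<alpha>" for x
        using IH[of x \<beta>] x n oa step(2) ordinal_mem[OF oa x] ordinal_trans[OF oa _ x] by auto
      moreover have "y \<in> elts \<alpha>" if y: "y \<in> elts \<beta>" for y
        using step(1)[of y] y n oa step(2) ordinal_mem[OF step(2) y] ordinal_trans[OF step(2) _ y] by auto
      ultimately have "elts \<alpha> = elts \<beta>" by auto
      then show False using n extensionality by auto
    qed
  qed
qed

section \<open>Levels of the cumulative hierarchy\<close>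

lemma VlevelI: "\<beta> \<in> elts \<alpha> \<Longrightarrow> elts x \<subseteq> Vlevel \<beta> \<Longrightarrow> x \<in> Vlevel \<alpha>"
  by (subst Vlevel.simps) auto

lemma VlevelE:
  assumes "x \<in> Vlevel \<alpha>"
  obtains \<beta> where "\<beta> \<in> elts \<alpha>" "elts x \<subseteq> Vlevel \<beta>"
  using assms by (subst (asm) Vlevel.simps) auto

lemma Vlevel_small: "\<exists>z. elts z = Vlevel (\<alpha>::'v::zfc_universe)"
proof (induction \<alpha> rule: mem_induct)
  case (step \<alpha>)
  define pw where "pw \<beta> = mk_set {x. elts x \<subseteq> Vlevel \<beta>}" for \<beta> :: 'v
  have pw: "elts (pw \<beta>) = {x. elts x \<subseteq> Vlevel \<beta>}" if b: "\<beta> \<in> elts \<alpha>" for \<beta>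
  proof -
    obtain z where z: "elts z = Vlevel \<beta>" using step[OF b] by blast
    obtain p where "elts p = {x. elts x \<subseteq> elts z}" using powerset[of z] by auto
    then show ?thesis unfolding pw_def by (intro elts_mk_set_eq) (simp add: z)
  qed
  obtain y where y: "elts y = pw ` elts \<alpha>" using replacement[of pw \<alpha>] by auto
  obtain u where u: "elts u = (\<Union>z\<in>elts y. elts z)" using union[of y] by auto
  have "elts u = Vlevel \<alpha>" unfolding u y by (subst Vlevel.simps) (use pw in auto)
  then show ?case by blast
qed

definition level :: "'v::zfc_universe \<Rightarrow> 'v" where
  "level \<alpha> = mk_set (Vlevel \<alpha>)"

lemma elts_level [simp]: "elts (level \<alpha>) = Vlevel \<alpha>"
  unfolding level_def by (rule exE[OF Vlevel_small[of \<alpha>]]) (rule elts_mk_set_eq)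

lemma level_mem: "\<alpha> \<in> elts \<beta> \<Longrightarrow> level \<alpha> \<in> Vlevel \<beta>"
  by (rule VlevelI) auto

lemma Vlevel_mono: "ordinal \<beta> \<Longrightarrow> \<alpha> \<in> elts \<beta> \<Longrightarrow> Vlevel \<alpha> \<subseteq> Vlevel \<beta>"
  by (meson VlevelE VlevelI ordinal_trans subsetI)

lemma Vlevel_trans: "ordinal \<beta> \<Longrightarrow> x \<in> Vlevel \<beta> \<Longrightarrow> y \<in> elts x \<Longrightarrow> y \<in> Vlevel \<beta>"
  by (meson VlevelE Vlevel_mono subsetD)

lemma ordinal_subset_Vlevel: "ordinal \<alpha> \<Longrightarrow> elts \<alpha> \<subseteq> Vlevel (\<alpha>::'v::zfc_universe)"
proof (induction \<alpha> rule: mem_induct)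
  case (step \<alpha>)
  show ?case
  proof
    fix \<gamma> assume g: "\<gamma> \<in> elts \<alpha>"
    show "\<gamma> \<in> Vlevel \<alpha>"
      using step(1)[OF g ordinal_mem[OF step(2) g]] by (rule VlevelI[OF g])
  qed
qed

lemma ordinal_notin_Vlevel: "ordinal \<alpha> \<Longrightarrow> (\<alpha>::'v::zfc_universe) \<notin> Vlevel \<alpha>"
proof (induction \<alpha> rule: mem_induct)
  case (step \<alpha>)
  show ?case
  proof
    assume "\<alpha> \<in> Vlevel \<alpha>"
    then obtain \<gamma> where g: "\<gamma> \<in> elts \<alpha>" "elts \<alpha> \<subseteq> Vlevel \<gamma>" by (rule VlevelE)
    then show False using step(1)[OF g(1) ordinal_mem[OF step(2) g(1)]] by auto
  qed
qed

lemma ordinal_in_Vlevel_iff: "ordinal \<alpha> \<Longrightarrow> ordinal \<beta> \<Longrightarrow> \<alpha> \<in> Vlevel \<beta> \<longleftrightarrow> \<alpha> \<in> elts \<beta>"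
  using ordinal_linear[of \<alpha> \<beta>] ordinal_subset_Vlevel[of \<beta>] ordinal_notin_Vlevel[of \<alpha>] Vlevel_mono[of \<alpha> \<beta>]
  by auto

lemma level_in_Vlevel_iff: "ordinal \<alpha> \<Longrightarrow> ordinal \<beta> \<Longrightarrow> level \<alpha> \<in> Vlevel \<beta> \<longleftrightarrow> \<alpha> \<in> elts \<beta>"
  using ordinal_linear[of \<alpha> \<beta>] level_mem[of \<alpha> \<beta>] mem_irrefl[of "level \<alpha>"] Vlevel_mono[of \<alpha> \<beta>]
  by auto

text \<open>For an ordinal \<beta> this means a nonzero limit. It is phrased through the elements of
  the level so that the first-order sentence \<open>fLim\<close> can express it.\<close>

definition limit_level :: "'v::zfc_universe \<Rightarrow> bool" where
  "limit_level \<beta> \<longleftrightarrow> ordinal \<beta> \<and> Vlevel \<beta> \<noteq> {} \<and> (\<forall>x\<in>Vlevel \<beta>. \<exists>y\<in>Vlevel \<beta>. x \<in> elts y)"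

lemma limit_level_ordinal: "limit_level \<beta> \<Longrightarrow> ordinal \<beta>"
  unfolding limit_level_def by blast

lemma limit_level_below: "limit_level \<beta> \<Longrightarrow> x \<in> Vlevel \<beta> \<Longrightarrow> \<exists>\<xi>\<in>elts \<beta>. x \<in> Vlevel \<xi>"
  unfolding limit_level_def by (meson VlevelE subsetD)

lemma limit_level_subset: "limit_level \<beta> \<Longrightarrow> elts x \<subseteq> Vlevel \<xi> \<Longrightarrow> \<xi> \<in> elts \<beta> \<Longrightarrow> x \<in> Vlevel \<beta>"
  by (rule VlevelI)

lemma limit_level_upair:
  assumes "limit_level \<beta>" "x \<in> Vlevel \<beta>" "y \<in> Vlevel \<beta>"
  shows "upair x y \<in> Vlevel \<beta>"
proof -
  obtain \<xi> \<eta> where 1: "\<xi> \<in> elts \<beta>" "x \<in> Vlevel \<xi>" "\<eta> \<in> elts \<beta>" "y \<in> Vlevel \<eta>"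
    using limit_level_below assms by meson
  have o: "ordinal \<xi>" "ordinal \<eta>" using 1 assms(1) limit_level_ordinal ordinal_mem by blast+
  from ordinal_linear[OF o] have "Vlevel \<xi> \<subseteq> Vlevel \<eta> \<or> Vlevel \<eta> \<subseteq> Vlevel \<xi>"
    using Vlevel_mono[OF o(1)] Vlevel_mono[OF o(2)] by auto
  then obtain \<zeta> where "\<zeta> \<in> elts \<beta>" "x \<in> Vlevel \<zeta>" "y \<in> Vlevel \<zeta>"
    using 1 by (elim disjE) auto
  then show ?thesis using limit_level_subset[OF assms(1), of "upair x y" \<zeta>] by auto
qed

lemma limit_level_kpair: "limit_level \<beta> \<Longrightarrow> x \<in> Vlevel \<beta> \<Longrightarrow> y \<in> Vlevel \<beta> \<Longrightarrow> kpair x y \<in> Vlevel \<beta>"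
  unfolding kpair_def by (intro limit_level_upair)

lemma limit_level_kpair_iff: "limit_level \<beta> \<Longrightarrow> kpair x y \<in> Vlevel \<beta> \<longleftrightarrow> x \<in> Vlevel \<beta> \<and> y \<in> Vlevel \<beta>"
proof
  assume b: "limit_level \<beta>" and k: "kpair x y \<in> Vlevel \<beta>"
  have "upair x y \<in> Vlevel \<beta>"
    by (rule Vlevel_trans[OF limit_level_ordinal[OF b] k]) (simp add: kpair_def)
  then show "x \<in> Vlevel \<beta> \<and> y \<in> Vlevel \<beta>"
    using Vlevel_trans[OF limit_level_ordinal[OF b]] by (metis elts_upair insertCI)
qed (use limit_level_kpair in blast)

lemma limit_level_vnum: "limit_level \<beta> \<Longrightarrow> vnum i \<in> Vlevel \<beta>"
proof (induction i)
  case 0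
  then obtain \<xi> where "\<xi> \<in> elts \<beta>" unfolding limit_level_def by (meson VlevelE ex_in_conv)
  then show ?case using limit_level_subset[OF 0, of "vnum 0" \<xi>] by simp
next
  case (Suc i)
  then show ?case using limit_level_upair by simp
qed

declare vnum.simps [simp del]

subsection \<open>Reflection below a level\<close>

definition closed_under :: "('v::zfc_universe \<Rightarrow> 'v) \<Rightarrow> 'v \<Rightarrow> bool" where
  "closed_under f \<alpha> \<longleftrightarrow> (\<forall>x\<in>Vlevel \<alpha>. f x \<in> Vlevel \<alpha>)"

text \<open>This plays the role of the club filter on \<beta>, with the closure points of a function
  on the level in place of a club. If some function has no limit closure point below \<beta>, the
  filter is improper and every \<open>P\<close> qualifies.\<close>

definition eventually_below :: "'v::zfc_universe \<Rightarrow> ('v \<Rightarrow> bool) \<Rightarrow> bool" where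
  "eventually_below \<beta> P \<longleftrightarrow> (\<exists>f. closed_under f \<beta> \<and> (\<forall>\<alpha>\<in>elts \<beta>. limit_level \<alpha> \<and> closed_under f \<alpha> \<longrightarrow> P \<alpha>))"

lemma eventually_belowI:
  assumes "\<And>x. x \<in> Vlevel \<beta> \<Longrightarrow> f x \<in> Vlevel \<beta>"
    and "\<And>\<alpha>. \<alpha> \<in> elts \<beta> \<Longrightarrow> limit_level \<alpha> \<Longrightarrow> (\<And>x. x \<in> Vlevel \<alpha> \<Longrightarrow> f x \<in> Vlevel \<alpha>) \<Longrightarrow> P \<alpha>"
  shows "eventually_below \<beta> P"
  unfolding eventually_below_def closed_under_def using assms by (intro exI[of _ f]) auto

lemma eventually_below_mono:
  "eventually_below \<beta> P \<Longrightarrow> (\<And>\<alpha>. \<alpha> \<in> elts \<beta> \<Longrightarrow> limit_level \<alpha> \<Longrightarrow> P \<alpha> \<Longrightarrow> Q \<alpha>) \<Longrightarrow> eventually_below \<beta> Q"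
  unfolding eventually_below_def by auto

lemma eventually_below_all: "(\<And>\<alpha>. \<alpha> \<in> elts \<beta> \<Longrightarrow> limit_level \<alpha> \<Longrightarrow> P \<alpha>) \<Longrightarrow> eventually_below \<beta> P"
  by (rule eventually_belowI[of _ "\<lambda>x. x"]) auto

text \<open>One function does the work of two: a level is transitive, so closure under the pair {f
  x, g x} gives closure under \<open>f\<close> and under \<open>g\<close>.\<close>

lemma eventually_below_conj:
  assumes b: "limit_level \<beta>" and "eventually_below \<beta> P" "eventually_below \<beta> Q"
  shows "eventually_below \<beta> (\<lambda>\<alpha>. P \<alpha> \<and> Q \<alpha>)"
proof -
  obtain f where f: "closed_under f \<beta>" "\<forall>\<alpha>\<in>elts \<beta>. limit_level \<alpha> \<and> closed_under f \<alpha> \<longrightarrow> P \<alpha>"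
    using assms unfolding eventually_below_def by auto
  obtain g where g: "closed_under g \<beta>" "\<forall>\<alpha>\<in>elts \<beta>. limit_level \<alpha> \<and> closed_under g \<alpha> \<longrightarrow> Q \<alpha>"
    using assms unfolding eventually_below_def by auto
  show ?thesis
  proof (rule eventually_belowI[of _ "\<lambda>x. upair (f x) (g x)"])
    fix x assume "x \<in> Vlevel \<beta>"
    then show "upair (f x) (g x) \<in> Vlevel \<beta>"
      using f g limit_level_upair[OF b] unfolding closed_under_def by auto
  next
    fix \<alpha> assume a: "\<alpha> \<in> elts \<beta>" "limit_level \<alpha>" and
      c: "\<And>x. x \<in> Vlevel \<alpha> \<Longrightarrow> upair (f x) (g x) \<in> Vlevel \<alpha>"
    have "f x \<in> Vlevel \<alpha> \<and> g x \<in> Vlevel \<alpha>" if "x \<in> Vlevel \<alpha>" for x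
      using Vlevel_trans[OF limit_level_ordinal[OF a(2)] c[OF that]] by simp
    then show "P \<alpha> \<and> Q \<alpha>" using f g a unfolding closed_under_def by auto
  qed
qed

text \<open>A nonempty level closed under the constant function with value x contains x.\<close>

lemma eventually_below_mem: "x \<in> Vlevel \<beta> \<Longrightarrow> eventually_below \<beta> (\<lambda>\<alpha>. x \<in> Vlevel \<alpha>)"
  by (rule eventually_belowI[of _ "\<lambda>_. x"]) (auto simp: limit_level_def)

text \<open>Properness of the filter of \<open>eventually_below\<close>. In ZFC this amounts to
  strong inaccessibility, but the closure form is the one that reflects directly and that
  \<open>fGood\<close> can state.\<close>

definition good :: "'v::zfc_universe \<Rightarrow> bool" where
  "good \<beta> \<longleftrightarrow> limit_level \<beta> \<and> (\<forall>P. eventually_below \<beta> P \<longrightarrow> (\<exists>\<alpha>\<in>elts \<beta>. limit_level \<alpha> \<and> P \<alpha>))"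

definition restr :: "'v::zfc_universe \<Rightarrow> (nat \<Rightarrow> 'v set) \<Rightarrow> nat \<Rightarrow> 'v set" where
  "restr \<alpha> U = (\<lambda>i. U i \<inter> Vlevel \<alpha>)"

text \<open>What is kept of elementarity: with the traces of \<open>U\<close> as arguments, the
  truth value of \<open>R\<close> is the same at almost all smaller levels. First-order conditions
  qualify by \<open>sat_elementary\<close>, and so do conditions not given by a first-order formula,
  as in \<open>reflective_bex_models\<close>.\<close>

definition reflective :: "('v::zfc_universe \<Rightarrow> (nat \<Rightarrow> 'v set) \<Rightarrow> bool) \<Rightarrow> bool" where
  "reflective R \<longleftrightarrow>
     (\<forall>\<beta> U. limit_level \<beta> \<and> (\<forall>i. U i \<subseteq> Vlevel \<beta>) \<longrightarrow> eventually_below \<beta> (\<lambda>\<alpha>. R \<alpha> (restr \<alpha> U) \<longleftrightarrow> R \<beta> U))"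

lemma reflectiveD:
  "reflective R \<Longrightarrow> limit_level \<beta> \<Longrightarrow> (\<And>i. U i \<subseteq> Vlevel \<beta>) \<Longrightarrow>
   eventually_below \<beta> (\<lambda>\<alpha>. R \<alpha> (restr \<alpha> U) \<longleftrightarrow> R \<beta> U)"
  unfolding reflective_def by auto

lemma reflective_Not: "reflective R \<Longrightarrow> reflective (\<lambda>\<alpha> U. \<not> R \<alpha> U)"
  unfolding reflective_def by simp

lemma reflective_disj:
  assumes "reflective R" "reflective R'"
  shows "reflective (\<lambda>\<alpha> U. R \<alpha> U \<or> R' \<alpha> U)"
  unfolding reflective_def
proof (intro allI impI)
  fix \<beta> and U :: "nat \<Rightarrow> 'a set"
  assume b: "limit_level \<beta> \<and> (\<forall>i. U i \<subseteq> Vlevel \<beta>)"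
  show "eventually_below \<beta> (\<lambda>\<alpha>. (R \<alpha> (restr \<alpha> U) \<or> R' \<alpha> (restr \<alpha> U)) \<longleftrightarrow> (R \<beta> U \<or> R' \<beta> U))"
    by (rule eventually_below_mono[OF eventually_below_conj[OF _ reflectiveD[OF assms(1), of \<beta> U]
          reflectiveD[OF assms(2), of \<beta> U]]])
      (use b in auto)
qed

subsection \<open>Second-order prefixes as games\<close>

text \<open>Coordinates are filled downwards: with m moves left, the next one goes to coordinate m -
  1. Thus \<open>U k\<close> is the opening move of a game of length \<open>Suc k\<close>, and the
  coordinates from m on are parameters. The flag \<open>b\<close> marks a universal move.\<close>

primrec game :: "bool \<Rightarrow> nat \<Rightarrow> 'v set \<Rightarrow> ((nat \<Rightarrow> 'v set) \<Rightarrow> bool) \<Rightarrow> (nat \<Rightarrow> 'v set) \<Rightarrow> bool" where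
  "game b 0 M Q U \<longleftrightarrow> Q U"
| "game b (Suc m) M Q U \<longleftrightarrow>
     (if b then \<forall>B. B \<subseteq> M \<longrightarrow> game False m M Q (U(m := B))
      else \<exists>B. B \<subseteq> M \<and> game True m M Q (U(m := B)))"

lemma game_cong:
  "(\<And>U'. (\<And>i. i \<ge> m \<Longrightarrow> U' i = U i) \<Longrightarrow> (\<And>i. i < m \<Longrightarrow> U' i \<subseteq> M) \<Longrightarrow> Q U' \<longleftrightarrow> Q' U') \<Longrightarrow>
   game b m M Q U \<longleftrightarrow> game b m M Q' U"
proof (induction m arbitrary: b U)
  case 0
  then show ?case by simp
next
  case (Suc m)
  have "game c m M Q (U(m := B)) \<longleftrightarrow> game c m M Q' (U(m := B))" if "B \<subseteq> M" for c B
    by (rule Suc.IH, rule Suc.prems) (use that less_Suc_eq in \<open>auto\<close>)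
  then show ?case by auto
qed

lemma game_Not: "\<not> game b m M Q U \<longleftrightarrow> game (\<not> b) m M (\<lambda>U. \<not> Q U) U"
  by (induction m arbitrary: b U) (auto split: if_splits)

lemma game_const: "game b m M (\<lambda>_. c) U \<longleftrightarrow> c"
  by (induction m arbitrary: b U) auto

lemma game_upd: "m \<le> k \<Longrightarrow> game b m M (\<lambda>U. Q (U(k := C))) U \<longleftrightarrow> game b m M Q (U(k := C))"
proof (induction m arbitrary: b U)
  case (Suc m)
  have "U(m := B, k := C) = U(k := C, m := B)" for B
    using Suc.prems by (intro fun_upd_twist) auto
  then have "game c m M (\<lambda>U. Q (U(k := C))) (U(m := B)) \<longleftrightarrow> game c m M Q (U(k := C, m := B))" for c B
    using Suc.IH[of c "U(m := B)"] Suc.prems by (simp only: Suc_leD)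
  then show ?case by (simp only: game.simps)
qed simp

text \<open>Otherwise \<open>Q\<close> could be replaced by \<open>False\<close>, and a game with a
  constant condition has that constant as its value, since every quantifier has at least the empty
  set in its range.\<close>

lemma game_leaf:
  assumes "game b m M Q U"
  shows "\<exists>U'. (\<forall>i\<ge>m. U' i = U i) \<and> Q U'"
proof (rule ccontr)
  assume "\<not> ?thesis"
  then have "game b m M Q U \<longleftrightarrow> game b m M (\<lambda>_. False) U" by (intro game_cong) auto
  then show False using assms game_const[of b m M False U] by auto
qed

section \<open>Satisfaction, first-order reflection and the translation of prefixes into
  games\<close>

lemma sat_cong:
  "(\<And>i. i \<in> free1 \<phi> \<Longrightarrow> s i = s' i) \<Longrightarrow> (\<And>i. i \<in> free2 \<phi> \<Longrightarrow> t i = t' i) \<Longrightarrow>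
   sat M A s t \<phi> \<longleftrightarrow> sat M A s' t' \<phi>"
proof (induction \<phi> arbitrary: s s' t t')
  case (Conj \<phi> \<psi>)
  have "sat M A s t \<phi> = sat M A s' t' \<phi>" "sat M A s t \<psi> = sat M A s' t' \<psi>"
    by (rule Conj.IH; simp add: Conj.prems)+
  then show ?case by simp
next
  case (Neg \<phi>)
  have "sat M A s t \<phi> = sat M A s' t' \<phi>" by (rule Neg.IH; simp add: Neg.prems)
  then show ?case by simp
next
  case (All x \<phi>)
  have "sat M A (s(x := a)) t \<phi> = sat M A (s'(x := a)) t' \<phi>" for a
    by (rule All.IH; simp add: All.prems)
  then show ?case by simp
next
  case (SAll X \<phi>)
  have "sat M A s (t(X := B)) \<phi> = sat M A s' (t'(X := B)) \<phi>" for B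
    by (rule SAll.IH; simp add: SAll.prems)
  then show ?case by simp
next
  case (SEx X \<phi>)
  have "sat M A s (t(X := B)) \<phi> = sat M A s' (t'(X := B)) \<phi>" for B
    by (rule SEx.IH; simp add: SEx.prems)
  then show ?case by simp
qed auto

lemma models_sentence: "sentence \<phi> \<Longrightarrow> models M A \<phi> \<longleftrightarrow> sat M A s t \<phi>"
  unfolding models_def sentence_def using sat_cong[of \<phi>] by (metis empty_iff)

primrec list_code :: "'v::zfc_universe list \<Rightarrow> 'v" where
  "list_code [] = vnum 0"
| "list_code (x # xs) = kpair x (list_code xs)"

lemma list_code_inject: "length xs = length ys \<Longrightarrow> list_code xs = list_code ys \<longleftrightarrow> xs = ys"
  by (induction xs ys rule: list_induct2) auto

lemma limit_level_list_code: "limit_level \<beta> \<Longrightarrow> set xs \<subseteq> Vlevel \<beta> \<Longrightarrow> list_code xs \<in> Vlevel \<beta>"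
  by (induction xs) (use limit_level_vnum[of \<beta> 0] limit_level_kpair in auto)

lemma finite_free1: "finite (free1 \<phi>)"
  by (induction \<phi>) auto

text \<open>The witness function $f$ below is a Skolem function for the outermost quantifier; finite
  assignments are coded as elements of the level.\<close>

lemma sat_elementary:
  assumes "limit_level \<beta>"
  shows "first_order \<phi> \<Longrightarrow> eventually_below \<beta> (\<lambda>\<alpha>. \<forall>s. (\<forall>i\<in>free1 \<phi>. s i \<in> Vlevel \<alpha>) \<longrightarrow>
     (sat (Vlevel \<alpha>) (A \<inter> Vlevel \<alpha>) s (restr \<alpha> t) \<phi> \<longleftrightarrow> sat (Vlevel \<beta>) A s t \<phi>))"
proof (induction \<phi>)
  case (Conj \<phi> \<psi>)
  from Conj show ?case
    by (intro eventually_below_mono[OF eventually_below_conj[OF assms Conj.IH]]) auto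
next
  case (Neg \<phi>)
  then show ?case by simp
next
  case (All x \<phi>)
  \<comment> \<open>\<open>N\<close> bounds the free variables of \<phi>, so assignments are coded
    by lists of one fixed length, on which \<open>list_code\<close> is injective.\<close>
  define N where "N = Suc (Max (insert 0 (free1 \<phi>)))"
  have N: "i < N" if "i \<in> free1 \<phi>" for i
    using that finite_free1[of \<phi>] unfolding N_def by (simp add: le_imp_less_Suc)
  define Q where "Q p a \<longleftrightarrow> a \<in> Vlevel \<beta> \<and>
      (\<exists>s. p = list_code (map s [0..<N]) \<and> \<not> sat (Vlevel \<beta>) A (s(x := a)) t \<phi>)" for p a
  \<comment> \<open>The default value \<open>p\<close> keeps the level closed under \<open>f\<close>
    when \<open>p\<close> codes no assignment that has a counterexample.\<close>
  define f where "f p = (if \<exists>a. Q p a then SOME a. Q p a else p)" for p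
  have fQ: "Q p (f p)" if "Q p a" for p a
    using someI[of "Q p" a] that unfolding f_def by auto
  have evf: "eventually_below \<beta> (closed_under f)"
  proof (rule eventually_belowI[of _ f])
    fix p assume p: "p \<in> Vlevel \<beta>"
    show "f p \<in> Vlevel \<beta>"
    proof (cases "\<exists>a. Q p a")
      case True
      then have "Q p (f p)" using fQ by auto
      then show ?thesis unfolding Q_def by auto
    qed (use p in \<open>simp add: f_def\<close>)
  qed (simp add: closed_under_def)
  have "first_order \<phi>" using All.prems by simp
  note IH = All.IH[OF this]
  show ?case
  proof (rule eventually_below_mono[OF eventually_below_conj[OF assms IH evf]], intro allI impI)
    fix \<alpha> s
    assume a: "\<alpha> \<in> elts \<beta>" "limit_level \<alpha>"
      and el: "(\<forall>s. (\<forall>i\<in>free1 \<phi>. s i \<in> Vlevel \<alpha>) \<longrightarrow>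
           sat (Vlevel \<alpha>) (A \<inter> Vlevel \<alpha>) s (restr \<alpha> t) \<phi> = sat (Vlevel \<beta>) A s t \<phi>) \<and> closed_under f \<alpha>"
      and s: "\<forall>i\<in>free1 (All x \<phi>). s i \<in> Vlevel \<alpha>"
    have sub: "Vlevel \<alpha> \<subseteq> Vlevel \<beta>" using Vlevel_mono[OF limit_level_ordinal[OF assms]] a by auto
    have e: "sat (Vlevel \<alpha>) (A \<inter> Vlevel \<alpha>) (s(x := c)) (restr \<alpha> t) \<phi> = sat (Vlevel \<beta>) A (s(x := c)) t \<phi>"
      if "c \<in> Vlevel \<alpha>" for c
      using el s that by auto
    have "\<exists>c\<in>Vlevel \<alpha>. \<not> sat (Vlevel \<beta>) A (s(x := c)) t \<phi>"
      if d: "d \<in> Vlevel \<beta>" "\<not> sat (Vlevel \<beta>) A (s(x := d)) t \<phi>" for d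
    proof -
      \<comment> \<open>Variables that are not free may have values outside V_\<alpha>. They are
        reset to a numeral so that the code of the assignment belongs to V_\<alpha>.\<close>
      define s' where "s' i = (if i \<in> free1 (All x \<phi>) then s i else vnum 0)" for i
      have s': "s' i \<in> Vlevel \<alpha>" for i using s limit_level_vnum[OF a(2)] unfolding s'_def by auto
      have c1: "sat (Vlevel \<beta>) A (s'(x := c)) t \<phi> = sat (Vlevel \<beta>) A (s(x := c)) t \<phi>" for c
        by (rule sat_cong) (auto simp: s'_def)
      define p where "p = list_code (map s' [0..<N])"
      have p: "p \<in> Vlevel \<alpha>" unfolding p_def by (rule limit_level_list_code[OF a(2)]) (use s' in auto)
      have "Q p d" unfolding Q_def p_def using d c1 by auto
      then have "Q p (f p)" by (rule fQ)
      then obtain s'' where s'': "p = list_code (map s'' [0..<N])" "\<not> sat (Vlevel \<beta>) A (s''(x := f p)) t \<phi>"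
        unfolding Q_def by auto
      have "map s'' [0..<N] = map s' [0..<N]"
        using s''(1) unfolding p_def by (subst (asm) list_code_inject) auto
      then have "s'' i = s' i" if "i < N" for i using that by auto
      then have "sat (Vlevel \<beta>) A (s''(x := f p)) t \<phi> = sat (Vlevel \<beta>) A (s'(x := f p)) t \<phi>"
        using N by (intro sat_cong) auto
      then have "\<not> sat (Vlevel \<beta>) A (s(x := f p)) t \<phi>" using s'' c1 by auto
      moreover have "f p \<in> Vlevel \<alpha>" using el p unfolding closed_under_def by auto
      ultimately show ?thesis by auto
    qed
    then show "sat (Vlevel \<alpha>) (A \<inter> Vlevel \<alpha>) s (restr \<alpha> t) (All x \<phi>) = sat (Vlevel \<beta>) A s t (All x \<phi>)"
      using e sub by auto
  qed
qed (auto intro!: eventually_below_all simp: restr_def)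

definition prenex :: "bool \<Rightarrow> nat \<Rightarrow> fm \<Rightarrow> bool" where
  "prenex b m \<phi> = (if b then Pi1 m \<phi> else Sigma1 m \<phi>)"

definition overwrite :: "nat set \<Rightarrow> (nat \<Rightarrow> 'v set) \<Rightarrow> (nat \<Rightarrow> 'v set) \<Rightarrow> nat \<Rightarrow> 'v set" where
  "overwrite I t u = (\<lambda>i. if i \<in> I then u i else t i)"

lemma overwrite_insert: "overwrite (insert X I) t u = overwrite I (t(X := u X)) u"
  by (rule ext) (auto simp: overwrite_def)

text \<open>A block of equal quantifiers, of any length and with repeated variables, becomes one
  quantification over a family \<open>u\<close>, of which the indices in \<open>I\<close> are read.
  The type argument fixes the universe in which the equivalence is stated; for n = 0 there is no
  block to remove and the condition is vacuous.\<close>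

definition block :: "bool \<Rightarrow> 'v::zfc_universe itself \<Rightarrow> nat \<Rightarrow> fm \<Rightarrow> bool" where
  "block b _ n \<phi> \<longleftrightarrow> (\<forall>m. n = Suc m \<longrightarrow> (\<exists>I \<psi>. prenex (\<not> b) m \<psi> \<and> free1 \<psi> = free1 \<phi> \<and>
     (\<forall>(M::'v set) A s t. sat M A s t \<phi> \<longleftrightarrow>
        (if b then \<forall>u. (\<forall>i. u i \<subseteq> M) \<longrightarrow> sat M A s (overwrite I t u) \<psi>
         else \<exists>u. (\<forall>i. u i \<subseteq> M) \<and> sat M A s (overwrite I t u) \<psi>))))"

lemma block_dummy: "prenex (\<not> b) m \<phi> \<Longrightarrow> block b TYPE('v::zfc_universe) (Suc m) \<phi>"
  unfolding block_def by (auto intro!: exI[of _ "{}"] exI[of _ \<phi>] simp: overwrite_def)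

lemma overwrite_shadow: "X \<in> I \<Longrightarrow> overwrite I (t(X := B)) u = overwrite I t u"
  by (rule ext) (auto simp: overwrite_def)

lemma overwrite_upd: "X \<notin> I \<Longrightarrow> overwrite I (t(X := B)) u = overwrite (insert X I) t (u(X := B))"
  by (rule ext) (auto simp: overwrite_def)

text \<open>If X is in I, a quantifier further inside rebinds it and the new one is void. Otherwise
  X joins I and its value is stored as \<open>u X\<close>.\<close>

lemma block_SAll:
  assumes "block True TYPE('v::zfc_universe) (Suc m) \<phi>"
  shows "block True TYPE('v) (Suc m) (SAll X \<phi>)"
proof -
  obtain I \<psi> where 1: "prenex False m \<psi>" "free1 \<psi> = free1 \<phi>"
    and sat: "\<And>(M::'v set) A s t. sat M A s t \<phi> \<longleftrightarrow> (\<forall>u. (\<forall>i. u i \<subseteq> M) \<longrightarrow> sat M A s (overwrite I t u) \<psi>)"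
    using assms unfolding block_def by auto
  have "sat M A s t (SAll X \<phi>) \<longleftrightarrow> (\<forall>u. (\<forall>i. u i \<subseteq> M) \<longrightarrow> sat M A s (overwrite (insert X I) t u) \<psi>)"
    for M :: "'v set" and A s t
  proof (cases "X \<in> I")
    case True
    then have "insert X I = I" by auto
    then show ?thesis using sat by (auto simp: overwrite_shadow[OF True])
  next
    case False
    show ?thesis
    proof
      assume "sat M A s t (SAll X \<phi>)"
      then show "\<forall>u. (\<forall>i. u i \<subseteq> M) \<longrightarrow> sat M A s (overwrite (insert X I) t u) \<psi>"
        using sat by (simp add: overwrite_insert)
    next
      assume r: "\<forall>u. (\<forall>i. u i \<subseteq> M) \<longrightarrow> sat M A s (overwrite (insert X I) t u) \<psi>"
      have "sat M A s (overwrite I (t(X := B)) u) \<psi>" if "B \<subseteq> M" "\<forall>i. u i \<subseteq> M" for B u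
        unfolding overwrite_upd[OF False] using r that by auto
      then show "sat M A s t (SAll X \<phi>)" using sat by auto
    qed
  qed
  then show ?thesis unfolding block_def using 1 by (auto intro!: exI[of _ "insert X I"] exI[of _ \<psi>])
qed

lemma block_SEx:
  assumes "block False TYPE('v::zfc_universe) (Suc m) \<phi>"
  shows "block False TYPE('v) (Suc m) (SEx X \<phi>)"
proof -
  obtain I \<psi> where 1: "prenex True m \<psi>" "free1 \<psi> = free1 \<phi>"
    and sat: "\<And>(M::'v set) A s t. sat M A s t \<phi> \<longleftrightarrow> (\<exists>u. (\<forall>i. u i \<subseteq> M) \<and> sat M A s (overwrite I t u) \<psi>)"
    using assms unfolding block_def by auto
  have "sat M A s t (SEx X \<phi>) \<longleftrightarrow> (\<exists>u. (\<forall>i. u i \<subseteq> M) \<and> sat M A s (overwrite (insert X I) t u) \<psi>)"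
    for M :: "'v set" and A s t
  proof (cases "X \<in> I")
    case True
    then have "insert X I = I" by auto
    then show ?thesis using sat by (auto simp: overwrite_shadow[OF True])
  next
    case False
    show ?thesis
    proof
      assume "\<exists>u. (\<forall>i. u i \<subseteq> M) \<and> sat M A s (overwrite (insert X I) t u) \<psi>"
      then show "sat M A s t (SEx X \<phi>)"
        unfolding sat.simps sat overwrite_insert by blast
    next
      assume "sat M A s t (SEx X \<phi>)"
      then obtain B u where "B \<subseteq> M" "\<forall>i. u i \<subseteq> M" "sat M A s (overwrite I (t(X := B)) u) \<psi>"
        using sat by auto
      then show "\<exists>u. (\<forall>i. u i \<subseteq> M) \<and> sat M A s (overwrite (insert X I) t u) \<psi>"
        unfolding overwrite_upd[OF False] by (intro exI[of _ "u(X := B)"]) auto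
    qed
  qed
  then show ?thesis unfolding block_def using 1 by (auto intro!: exI[of _ "insert X I"] exI[of _ \<psi>])
qed

lemma block_prenex:
  "Pi1 n \<phi> \<Longrightarrow> block True TYPE('v::zfc_universe) n \<phi>"
  "Sigma1 n \<phi> \<Longrightarrow> block False TYPE('v) n \<phi>"
proof (induction n \<phi> and n \<phi> rule: Pi1_Sigma1.inducts)
  case (Pi1_Suc m \<phi>)
  then show ?case by (intro block_dummy) (simp add: prenex_def)
next
  case (Sigma1_Suc m \<phi>)
  then show ?case by (intro block_dummy) (simp add: prenex_def)
next
  case (Pi1_SAll m \<phi> X)
  then show ?case by (intro block_SAll)
next
  case (Sigma1_SEx m \<phi> X)
  then show ?case by (intro block_SEx)
qed (simp_all add: block_def)

text \<open>Contraction of a sequence of sets into one: the pairs in \<open>B\<close> tagged with i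
  yield the i-th set. It turns a whole block into a single move.\<close>

definition slice :: "'v::zfc_universe set \<Rightarrow> 'v set \<Rightarrow> nat \<Rightarrow> 'v set" where
  "slice M B i = {x \<in> M. kpair (vnum i) x \<in> B}"

lemma slice_surj:
  assumes "limit_level \<beta>" "\<And>i. u i \<subseteq> Vlevel \<beta>"
  shows "\<exists>B. B \<subseteq> Vlevel \<beta> \<and> slice (Vlevel \<beta>) B = u"
proof (intro exI conjI)
  let ?B = "{kpair (vnum i) x | i x. x \<in> u i}"
  show "?B \<subseteq> Vlevel \<beta>" using limit_level_kpair limit_level_vnum assms by blast
  show "slice (Vlevel \<beta>) ?B = u"
    unfolding slice_def using assms(2) by (auto intro!: ext)
qed

text \<open>Variable i is read from slice i of the move \<open>j i\<close>. A value
  \<open>j i\<close> of at least m marks a variable that is not quantified and keeps its value under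
  \<open>t\<close>.\<close>

definition decode :: "(nat \<Rightarrow> nat) \<Rightarrow> nat \<Rightarrow> (nat \<Rightarrow> 'v::zfc_universe set) \<Rightarrow> 'v set \<Rightarrow> (nat \<Rightarrow> 'v set) \<Rightarrow> nat \<Rightarrow> 'v set"
  where "decode j m t M U = (\<lambda>i. if j i < m then slice M (U (j i)) i else t i)"

text \<open>Induction on the number of blocks: the outermost block ranges over families of subsets
  of V_\<beta>, and by \<open>slice_surj\<close> these are exactly the families of slices of a
  single subset.\<close>

lemma prenex_game:
  "prenex b m \<phi> \<Longrightarrow> \<exists>j \<psi>. first_order \<psi> \<and> free1 \<psi> = free1 \<phi> \<and>
     (\<forall>(\<beta>::'v::zfc_universe) A s t U. limit_level \<beta> \<longrightarrow>
        (sat (Vlevel \<beta>) A s t \<phi> \<longleftrightarrow>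
         game b m (Vlevel \<beta>) (\<lambda>U. sat (Vlevel \<beta>) A s (decode j m t (Vlevel \<beta>) U) \<psi>) U))"
proof (induction m arbitrary: b \<phi>)
  case 0
  then have "first_order \<phi>" unfolding prenex_def by (auto elim: Pi1.cases Sigma1.cases split: if_splits)
  then show ?case by (intro exI[of _ "\<lambda>_. 0"] exI[of _ \<phi>]) (simp add: decode_def)
next
  case (Suc m)
  have "block b TYPE('v) (Suc m) \<phi>"
    using Suc.prems block_prenex unfolding prenex_def by (cases b) auto
  then obtain I \<psi>' where 1: "prenex (\<not> b) m \<psi>'" "free1 \<psi>' = free1 \<phi>"
    and sat1: "\<And>(M::'v set) A s t. sat M A s t \<phi> \<longleftrightarrow>
        (if b then \<forall>u. (\<forall>i. u i \<subseteq> M) \<longrightarrow> sat M A s (overwrite I t u) \<psi>'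
         else \<exists>u. (\<forall>i. u i \<subseteq> M) \<and> sat M A s (overwrite I t u) \<psi>')"
    unfolding block_def by auto
  obtain j' \<psi> where 2: "first_order \<psi>" "free1 \<psi> = free1 \<psi>'"
    and sat2: "\<And>(\<beta>::'v) A s t U. limit_level \<beta> \<Longrightarrow> sat (Vlevel \<beta>) A s t \<psi>' \<longleftrightarrow>
         game (\<not> b) m (Vlevel \<beta>) (\<lambda>U. sat (Vlevel \<beta>) A s (decode j' m t (Vlevel \<beta>) U) \<psi>) U"
    using Suc.IH[OF 1(1)] by blast
  \<comment> \<open>A variable bound again further inside keeps its inner move, because the inner
    binding wins. One bound by the outermost block alone gets the new move m, and
    \<open>Suc m\<close> is out of range and means: not quantified.\<close>
  define j where "j i = (if j' i < m then j' i else if i \<in> I then m else Suc m)" for i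
  have "sat (Vlevel \<beta>) A s t \<phi> \<longleftrightarrow>
      game b (Suc m) (Vlevel \<beta>) (\<lambda>U. sat (Vlevel \<beta>) A s (decode j (Suc m) t (Vlevel \<beta>) U) \<psi>) U"
    if b: "limit_level \<beta>" for \<beta> :: 'v and A s t U
  proof -
    let ?V = "Vlevel \<beta>"
    have key: "game (\<not> b) m ?V (\<lambda>U. sat ?V A s (decode j (Suc m) t ?V U) \<psi>) (U(m := B)) \<longleftrightarrow>
        sat ?V A s (overwrite I t (slice ?V B)) \<psi>'" for B
    proof -
      have "decode j (Suc m) t ?V U' = decode j' m (overwrite I t (slice ?V B)) ?V U'" if "U' m = B" for U'
        using that by (intro ext) (simp add: decode_def j_def overwrite_def)
      then have "game (\<not> b) m ?V (\<lambda>U. sat ?V A s (decode j (Suc m) t ?V U) \<psi>) (U(m := B)) \<longleftrightarrow>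
          game (\<not> b) m ?V (\<lambda>U. sat ?V A s (decode j' m (overwrite I t (slice ?V B)) ?V U) \<psi>) (U(m := B))"
        by (intro game_cong) auto
      then show ?thesis using sat2[OF b] by auto
    qed
    have sl: "slice ?V B i \<subseteq> ?V" for B i unfolding slice_def by auto
    show ?thesis
    proof (cases b)
      case True
      have "(\<forall>u. (\<forall>i. u i \<subseteq> ?V) \<longrightarrow> sat ?V A s (overwrite I t u) \<psi>') \<longleftrightarrow>
          (\<forall>B. B \<subseteq> ?V \<longrightarrow> sat ?V A s (overwrite I t (slice ?V B)) \<psi>')"
        using sl slice_surj[OF b] by metis
      then show ?thesis using key True unfolding sat1 by simp
    next
      case False
      have "(\<exists>u. (\<forall>i. u i \<subseteq> ?V) \<and> sat ?V A s (overwrite I t u) \<psi>') \<longleftrightarrow>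
          (\<exists>B. B \<subseteq> ?V \<and> sat ?V A s (overwrite I t (slice ?V B)) \<psi>')"
        using sl slice_surj[OF b] by metis
      then show ?thesis using key False unfolding sat1 by simp
    qed
  qed
  then show ?case using 1 2 by (intro exI[of _ j] exI[of _ \<psi>]) auto
qed

section \<open>Closure points expressed by total relations\<close>

text \<open>A function on a level in a form over which a second-order variable can range. Values
  need not be unique, which keeps the formula simple; a choice function inside \<open>F\<close>
  gives closure points back.\<close>

definition total_rel :: "'v::zfc_universe set \<Rightarrow> 'v set \<Rightarrow> bool" where
  "total_rel F M \<longleftrightarrow> (\<forall>x\<in>M. \<exists>y\<in>M. kpair x y \<in> F)"

lemma eventually_below_total_rel:
  assumes "total_rel F (Vlevel \<beta>)"
  shows "eventually_below \<beta> (\<lambda>\<alpha>. total_rel F (Vlevel \<alpha>))"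
proof -
  obtain f where f: "\<And>x. x \<in> Vlevel \<beta> \<Longrightarrow> f x \<in> Vlevel \<beta> \<and> kpair x (f x) \<in> F"
    using assms unfolding total_rel_def by metis
  show ?thesis
  proof (rule eventually_belowI[of _ "\<lambda>x. if x \<in> Vlevel \<beta> then f x else x"])
    fix \<alpha> assume a: "\<alpha> \<in> elts \<beta>" "limit_level \<alpha>"
      and c: "\<And>x. x \<in> Vlevel \<alpha> \<Longrightarrow> (if x \<in> Vlevel \<beta> then f x else x) \<in> Vlevel \<alpha>"
    have "x \<in> Vlevel \<beta>" if x: "x \<in> Vlevel \<alpha>" for x
      using x
    proof (rule VlevelE)
      fix \<gamma> assume "\<gamma> \<in> elts \<alpha>" "elts x \<subseteq> Vlevel \<gamma>"
      then show ?thesis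
        using VlevelI[OF a(1), of x] Vlevel_mono[OF limit_level_ordinal[OF a(2)], of \<gamma>] by auto
    qed
    then show "total_rel F (Vlevel \<alpha>)" unfolding total_rel_def using f c by metis
  qed (use f in auto)
qed

lemma eventually_below_imp_total_rel:
  assumes b: "limit_level \<beta>" and "eventually_below \<beta> P"
  shows "\<exists>F. F \<subseteq> Vlevel \<beta> \<and> total_rel F (Vlevel \<beta>) \<and>
    (\<forall>\<alpha>\<in>elts \<beta>. limit_level \<alpha> \<and> total_rel F (Vlevel \<alpha>) \<longrightarrow> P \<alpha>)"
proof -
  obtain f where f: "closed_under f \<beta>" "\<forall>\<alpha>\<in>elts \<beta>. limit_level \<alpha> \<and> closed_under f \<alpha> \<longrightarrow> P \<alpha>"
    using assms unfolding eventually_below_def by auto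
  let ?F = "{kpair x (f x) | x. x \<in> Vlevel \<beta>}"
  have "?F \<subseteq> Vlevel \<beta>" using limit_level_kpair[OF b] f unfolding closed_under_def by auto
  moreover have "total_rel ?F (Vlevel \<beta>)" using f unfolding closed_under_def total_rel_def by auto
  moreover have "closed_under f \<alpha>" if "total_rel ?F (Vlevel \<alpha>)" for \<alpha>
    using that unfolding total_rel_def closed_under_def by auto
  ultimately show ?thesis using f by (intro exI[of _ ?F]) auto
qed

text \<open>Functions are tested through their graphs, so goodness becomes a statement that one
  universal set quantifier can make, as in \<open>fGood\<close>.\<close>

lemma goodI:
  assumes "limit_level \<beta>"
    and "\<And>F. F \<subseteq> Vlevel \<beta> \<Longrightarrow> total_rel F (Vlevel \<beta>) \<Longrightarrow> \<exists>\<alpha>\<in>elts \<beta>. limit_level \<alpha> \<and> total_rel F (Vlevel \<alpha>)"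
  shows "good \<beta>"
  unfolding good_def
proof (intro conjI allI impI)
  fix P assume "eventually_below \<beta> P"
  from eventually_below_imp_total_rel[OF assms(1) this] obtain F where F: "F \<subseteq> Vlevel \<beta>" "total_rel F (Vlevel \<beta>)"
    "\<forall>\<alpha>\<in>elts \<beta>. limit_level \<alpha> \<and> total_rel F (Vlevel \<alpha>) \<longrightarrow> P \<alpha>" by auto
  then show "\<exists>\<alpha>\<in>elts \<beta>. limit_level \<alpha> \<and> P \<alpha>" using assms(2)[OF F(1,2)] by auto
qed (rule assms)

lemma good_limit_level: "good \<beta> \<Longrightarrow> limit_level \<beta>"
  unfolding good_def by auto

lemma goodD: "good \<beta> \<Longrightarrow> eventually_below \<beta> P \<Longrightarrow> \<exists>\<alpha>\<in>elts \<beta>. limit_level \<alpha> \<and> P \<alpha>"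
  unfolding good_def by auto

text \<open>At a good level the truth of a reflective relation is both a $\Pi^1_1$ and a $\Sigma^1_1$
  statement about its values at lower levels.\<close>

lemma reflective_iff_all_total_rel:
  assumes "good \<beta>" "reflective R" "\<And>i. U i \<subseteq> Vlevel \<beta>"
  shows "R \<beta> U \<longleftrightarrow> (\<forall>F. F \<subseteq> Vlevel \<beta> \<longrightarrow> total_rel F (Vlevel \<beta>) \<longrightarrow>
     (\<exists>\<alpha>\<in>elts \<beta>. limit_level \<alpha> \<and> total_rel F (Vlevel \<alpha>) \<and> R \<alpha> (restr \<alpha> U)))"
proof -
  note b = good_limit_level[OF assms(1)]
  have e: "eventually_below \<beta> (\<lambda>\<alpha>. R \<alpha> (restr \<alpha> U) \<longleftrightarrow> R \<beta> U)"
    using reflectiveD[OF assms(2) b assms(3)] .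
  show ?thesis
  proof
    assume R: "R \<beta> U"
    show "\<forall>F. F \<subseteq> Vlevel \<beta> \<longrightarrow> total_rel F (Vlevel \<beta>) \<longrightarrow>
     (\<exists>\<alpha>\<in>elts \<beta>. limit_level \<alpha> \<and> total_rel F (Vlevel \<alpha>) \<and> R \<alpha> (restr \<alpha> U))"
    proof (intro allI impI)
      fix F assume "total_rel F (Vlevel \<beta>)"
      from goodD[OF assms(1) eventually_below_conj[OF b eventually_below_total_rel[OF this] e]]
      show "\<exists>\<alpha>\<in>elts \<beta>. limit_level \<alpha> \<and> total_rel F (Vlevel \<alpha>) \<and> R \<alpha> (restr \<alpha> U)" using R by auto
    qed
  next
    assume "\<forall>F. F \<subseteq> Vlevel \<beta> \<longrightarrow> total_rel F (Vlevel \<beta>) \<longrightarrow>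
     (\<exists>\<alpha>\<in>elts \<beta>. limit_level \<alpha> \<and> total_rel F (Vlevel \<alpha>) \<and> R \<alpha> (restr \<alpha> U))"
    then show "R \<beta> U" using eventually_below_imp_total_rel[OF b e] by auto
  qed
qed

lemma bex_Vlevel:
  assumes "limit_level \<beta>" "y \<in> Vlevel \<beta>"
  shows "(\<exists>x\<in>Vlevel \<beta>. x \<in> elts y \<and> P x) \<longleftrightarrow> (\<exists>x\<in>elts y. P x)"
    "(\<forall>x\<in>Vlevel \<beta>. x \<in> elts y \<longrightarrow> P x) \<longleftrightarrow> (\<forall>x\<in>elts y. P x)"
  using Vlevel_trans[OF limit_level_ordinal[OF assms(1)] assms(2)] by auto

subsection \<open>A universal formula\<close>

abbreviation (input) fImp where "fImp a b \<equiv> Neg (Conj a (Neg b))"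
abbreviation (input) fDisj where "fDisj a b \<equiv> Neg (Conj (Neg a) (Neg b))"
abbreviation (input) fIff where "fIff a b \<equiv> Conj (fImp a b) (fImp b a)"
abbreviation (input) fEx where "fEx x a \<equiv> Neg (All x (Neg a))"

text \<open>\<open>Suc (z + x + y)\<close> exceeds all three variables and is therefore fresh;
  \<open>fKp\<close> uses the same device.\<close>

definition fUp :: "nat \<Rightarrow> nat \<Rightarrow> nat \<Rightarrow> fm" where
  "fUp z x y = All (Suc (z + x + y))
     (fIff (Mem (Suc (z + x + y)) z) (fDisj (Eq (Suc (z + x + y)) x) (Eq (Suc (z + x + y)) y)))"

lemma fUp_syntax [simp]: "free1 (fUp z x y) = {x, y, z}" "free2 (fUp z x y) = {}" "first_order (fUp z x y)"
  unfolding fUp_def by auto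

lemma sat_fUp:
  assumes "limit_level \<beta>" "s x \<in> Vlevel \<beta>" "s y \<in> Vlevel \<beta>" "s z \<in> Vlevel \<beta>"
  shows "sat (Vlevel \<beta>) A s t (fUp z x y) \<longleftrightarrow> s z = upair (s x) (s y)"
proof -
  have "sat (Vlevel \<beta>) A s t (fUp z x y) \<longleftrightarrow>
      (\<forall>a\<in>Vlevel \<beta>. a \<in> elts (s z) \<longleftrightarrow> a = s x \<or> a = s y)"
    unfolding fUp_def by auto
  also have "\<dots> \<longleftrightarrow> elts (s z) = {s x, s y}"
    using assms Vlevel_trans[OF limit_level_ordinal[OF assms(1)] assms(4)] by blast
  finally show ?thesis by (simp add: upair_eq_iff)
qed

definition fKp :: "nat \<Rightarrow> nat \<Rightarrow> nat \<Rightarrow> fm" where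
  "fKp z x y = (let a = Suc (z + x + y); b = Suc a in
     fEx a (fEx b (Conj (fUp a x x) (Conj (fUp b x y) (fUp z a b)))))"

lemma fKp_syntax [simp]: "free1 (fKp z x y) = {x, y, z}" "free2 (fKp z x y) = {}" "first_order (fKp z x y)"
  unfolding fKp_def by (auto simp: Let_def)

lemma sat_fKp:
  assumes b: "limit_level \<beta>" and V: "s x \<in> Vlevel \<beta>" "s y \<in> Vlevel \<beta>" "s z \<in> Vlevel \<beta>"
  shows "sat (Vlevel \<beta>) A s t (fKp z x y) \<longleftrightarrow> s z = kpair (s x) (s y)"
proof -
  define a where "a = Suc (z + x + y)"
  have n: "a \<noteq> x" "a \<noteq> y" "a \<noteq> z" "Suc a \<noteq> x" "Suc a \<noteq> y" "Suc a \<noteq> z" unfolding a_def by auto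
  have "sat (Vlevel \<beta>) A s t (fKp z x y) \<longleftrightarrow>
      (\<exists>p\<in>Vlevel \<beta>. \<exists>q\<in>Vlevel \<beta>. p = upair (s x) (s x) \<and> q = upair (s x) (s y) \<and> s z = upair p q)"
    unfolding fKp_def Let_def a_def[symmetric] using n V
    by (simp add: sat_fUp[OF b] cong: bex_cong)
  then show ?thesis using limit_level_upair[OF b] V unfolding kpair_def by auto
qed

primrec fNum :: "nat \<Rightarrow> nat \<Rightarrow> fm" where
  "fNum 0 z = All (Suc z) (Neg (Mem (Suc z) z))"
| "fNum (Suc i) z = All (Suc z) (fIff (Mem (Suc z) z) (fNum i (Suc z)))"

lemma fNum_syntax [simp]: "free1 (fNum i z) = {z}" "free2 (fNum i z) = {}" "first_order (fNum i z)"
  by (induction i arbitrary: z) auto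

lemma sat_fNum:
  assumes b: "limit_level \<beta>"
  shows "s z \<in> Vlevel \<beta> \<Longrightarrow> sat (Vlevel \<beta>) A s t (fNum i z) \<longleftrightarrow> s z = vnum i"
proof (induction i arbitrary: s z)
  case 0
  have "sat (Vlevel \<beta>) A s t (fNum 0 z) \<longleftrightarrow> elts (s z) = {}"
    using Vlevel_trans[OF limit_level_ordinal[OF b] 0] by auto
  also have "\<dots> \<longleftrightarrow> s z = vnum 0"
    using extensionality[of "s z" "vnum 0"] by (auto simp: vnum.simps)
  finally show ?case .
next
  case (Suc i)
  have "sat (Vlevel \<beta>) A s t (fNum (Suc i) z) \<longleftrightarrow> (\<forall>a\<in>Vlevel \<beta>. a \<in> elts (s z) \<longleftrightarrow> a = vnum i)"
    using Suc.IH by auto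
  also have "\<dots> \<longleftrightarrow> elts (s z) = {vnum i}"
    using Vlevel_trans[OF limit_level_ordinal[OF b] Suc.prems] limit_level_vnum[OF b, of i] by blast
  finally show ?case by (simp add: vnum.simps upair_eq_iff)
qed

text \<open>The relativisation of \<open>fTot\<close> to a smaller level, given as the element named
  by v. Its bound variables 5, 6 and 7 stay clear of 0 to 4, which \<open>fMatch\<close> and
  \<open>fGood\<close> use.\<close>

definition fTotIn :: "nat \<Rightarrow> nat \<Rightarrow> fm" where
  "fTotIn v F = All 5 (fImp (Mem 5 v) (fEx 6 (Conj (Mem 6 v) (fEx 7 (Conj (fKp 7 5 6) (SMem 7 F))))))"

text \<open>Variable 7 holds the pair. The atom that tests it is left open, so that the relation can
  be a second-order variable or the predicate \<open>A\<close>.\<close>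

definition fTot :: "fm \<Rightarrow> fm" where
  "fTot a = All 5 (fEx 6 (fEx 7 (Conj (fKp 7 5 6) a)))"

lemma fTotIn_syntax [simp]: "v < 5 \<Longrightarrow> free1 (fTotIn v F) = {v}" "free2 (fTotIn v F) = {F}" "first_order (fTotIn v F)"
  unfolding fTotIn_def by auto

lemma sat_fTotIn:
  assumes b: "limit_level \<beta>" and v: "v < 5" "s v \<in> Vlevel \<beta>"
  shows "sat (Vlevel \<beta>) A s t (fTotIn v F) \<longleftrightarrow> total_rel (t F) (elts (s v))"
proof -
  have n: "v \<noteq> 5" "v \<noteq> 6" "v \<noteq> 7" using v by auto
  have "sat (Vlevel \<beta>) A s t (fTotIn v F) \<longleftrightarrow>
     (\<forall>x\<in>Vlevel \<beta>. x \<in> elts (s v) \<longrightarrow> (\<exists>y\<in>Vlevel \<beta>. y \<in> elts (s v) \<and> (\<exists>z\<in>Vlevel \<beta>. z = kpair x y \<and> z \<in> t F)))"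
    unfolding fTotIn_def using n by (simp add: sat_fKp[OF b] cong: bex_cong ball_cong)
  also have "\<dots> \<longleftrightarrow> total_rel (t F) (elts (s v))"
    using Vlevel_trans[OF limit_level_ordinal[OF b] v(2)]
    by (fastforce simp: limit_level_kpair_iff[OF b] total_rel_def)
  finally show ?thesis .
qed

lemma sat_fTot:
  assumes b: "limit_level \<beta>"
  shows "sat (Vlevel \<beta>) A s t (fTot (SMem 7 F)) \<longleftrightarrow> total_rel (t F) (Vlevel \<beta>)"
    and "sat (Vlevel \<beta>) A s t (fTot (InA 7)) \<longleftrightarrow> total_rel A (Vlevel \<beta>)"
  unfolding fTot_def total_rel_def
  by (auto simp: sat_fKp[OF b] limit_level_kpair_iff[OF b] cong: bex_cong ball_cong)

primrec fConjs :: "(nat \<Rightarrow> fm) \<Rightarrow> nat \<Rightarrow> fm" where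
  "fConjs f 0 = All 0 (Eq 0 0)"
| "fConjs f (Suc n) = Conj (f n) (fConjs f n)"

lemma fConjs_syntax [simp]:
  "free1 (fConjs f n) = (\<Union>i<n. free1 (f i))" "free2 (fConjs f n) = (\<Union>i<n. free2 (f i))"
  "first_order (fConjs f n) \<longleftrightarrow> (\<forall>i<n. first_order (f i))"
  by (induction n) (auto simp: lessThan_Suc less_Suc_eq)

lemma sat_fConjs: "sat M A s t (fConjs f n) \<longleftrightarrow> (\<forall>i<n. sat M A s t (f i))"
  by (induction n) (auto simp: less_Suc_eq)

text \<open>Meant for \<open>params\<close> as the predicate: w is a level code, v its greatest
  member, hence the coded level V_\<alpha>, and the clauses for i < m say that w codes the traces on
  V_\<alpha> of the current sets. So the winning condition holds of these traces at some \<alpha> at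
  which \<open>F\<close> is total.\<close>

definition fMatch :: "nat \<Rightarrow> nat \<Rightarrow> fm" where
  "fMatch m F = fEx 0 (Conj (InA 0) (fEx 1 (Conj (Mem 1 0)
     (Conj (All 2 (fImp (Mem 2 0) (fDisj (Eq 2 1) (Mem 2 1))))
     (Conj (fTotIn 1 F)
       (fConjs (\<lambda>i. All 2 (fImp (Mem 2 1) (fIff (SMem 2 i)
          (fEx 3 (Conj (Mem 3 0) (fEx 4 (Conj (fNum i 4) (fKp 3 4 2)))))))) m))))))"

lemma fMatch_syntax [simp]: "free1 (fMatch m F) = {}" "free2 (fMatch m F) = {F} \<union> {..<m}" "first_order (fMatch m F)"
  unfolding fMatch_def by auto

lemma sat_fMatch:
  assumes b: "limit_level \<beta>"
  shows "sat (Vlevel \<beta>) A s t (fMatch m F) \<longleftrightarrow>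
    (\<exists>w\<in>Vlevel \<beta> \<inter> A. \<exists>v\<in>elts w. (\<forall>z\<in>elts w. z = v \<or> z \<in> elts v) \<and> total_rel (t F) (elts v) \<and>
       (\<forall>i<m. \<forall>x\<in>elts v. x \<in> t i \<longleftrightarrow> kpair (vnum i) x \<in> elts w))"
proof -
  have inn: "(\<exists>z\<in>Vlevel \<beta>. z \<in> elts w \<and> (\<exists>u\<in>Vlevel \<beta>. u = vnum i \<and> z = kpair u x)) \<longleftrightarrow> kpair (vnum i) x \<in> elts w"
    if "w \<in> Vlevel \<beta>" for w x i
    using Vlevel_trans[OF limit_level_ordinal[OF b] that] limit_level_vnum[OF b, of i] by auto
  have "sat (Vlevel \<beta>) A s t (fMatch m F) \<longleftrightarrow>
    (\<exists>w\<in>Vlevel \<beta>. w \<in> A \<and> (\<exists>v\<in>Vlevel \<beta>. v \<in> elts w \<and>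
       (\<forall>z\<in>Vlevel \<beta>. z \<in> elts w \<longrightarrow> z = v \<or> z \<in> elts v) \<and> total_rel (t F) (elts v) \<and>
       (\<forall>i<m. \<forall>x\<in>Vlevel \<beta>. x \<in> elts v \<longrightarrow> (x \<in> t i \<longleftrightarrow> 
          (\<exists>z\<in>Vlevel \<beta>. z \<in> elts w \<and> (\<exists>u\<in>Vlevel \<beta>. u = vnum i \<and> z = kpair u x))))))"
    unfolding fMatch_def
    by (simp add: sat_fTotIn[OF b] sat_fConjs sat_fNum[OF b] sat_fKp[OF b] cong: bex_cong ball_cong conj_cong)
      (rule bex_cong[OF refl], rule conj_cong[OF refl], rule bex_cong[OF refl], blast)
  also have "\<dots> \<longleftrightarrow> (\<exists>w\<in>Vlevel \<beta>. w \<in> A \<and> (\<exists>v\<in>Vlevel \<beta>. v \<in> elts w \<and>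
       (\<forall>z\<in>Vlevel \<beta>. z \<in> elts w \<longrightarrow> z = v \<or> z \<in> elts v) \<and> total_rel (t F) (elts v) \<and>
       (\<forall>i<m. \<forall>x\<in>Vlevel \<beta>. x \<in> elts v \<longrightarrow> (x \<in> t i \<longleftrightarrow> kpair (vnum i) x \<in> elts w))))"
    by (intro bex_cong refl) (simp only: inn)
  also have "\<dots> \<longleftrightarrow> (\<exists>w\<in>Vlevel \<beta> \<inter> A. \<exists>v\<in>elts w. (\<forall>z\<in>elts w. z = v \<or> z \<in> elts v) \<and> total_rel (t F) (elts v) \<and>
       (\<forall>i<m. \<forall>x\<in>elts v. x \<in> t i \<longleftrightarrow> kpair (vnum i) x \<in> elts w))"
    by (simp add: bex_Vlevel[OF b] Bex_def[of "Vlevel \<beta> \<inter> _"] cong: bex_cong conj_cong) auto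
  finally show ?thesis .
qed

definition fLim :: fm where
  "fLim = Conj (fEx 0 (Eq 0 0)) (All 0 (fEx 1 (Mem 0 1)))"

lemma fLim_syntax [simp]: "free1 fLim = {}" "free2 fLim = {}" "first_order fLim"
  unfolding fLim_def by auto

lemma sat_fLim: "ordinal \<beta> \<Longrightarrow> sat (Vlevel \<beta>) A s t fLim \<longleftrightarrow> limit_level \<beta>"
  unfolding fLim_def limit_level_def by auto

text \<open>The clause that every member of v lies in a member of v selects the bare levels of
  \<open>params\<close>: a level code has its level as a member, and this lies in no other
  member.\<close>

definition fGood :: "nat \<Rightarrow> fm" where
  "fGood k = fImp (fTot (SMem 7 k)) (fEx 1 (Conj (InA 1)
     (Conj (All 2 (fImp (Mem 2 1) (fEx 3 (Conj (Mem 3 1) (Mem 2 3))))) (fTotIn 1 k))))"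

lemma fGood_syntax [simp]: "free1 (fGood k) = {}" "free2 (fGood k) = {k}" "first_order (fGood k)"
  unfolding fGood_def fTot_def by auto

lemma sat_fGood:
  assumes b: "limit_level \<beta>"
  shows "sat (Vlevel \<beta>) A s t (fGood k) \<longleftrightarrow> (total_rel (t k) (Vlevel \<beta>) \<longrightarrow>
     (\<exists>v\<in>Vlevel \<beta> \<inter> A. (\<forall>x\<in>elts v. \<exists>y\<in>elts v. x \<in> elts y) \<and> total_rel (t k) (elts v)))"
proof -
  have "sat (Vlevel \<beta>) A s t (fGood k) \<longleftrightarrow> (total_rel (t k) (Vlevel \<beta>) \<longrightarrow>
     (\<exists>v\<in>Vlevel \<beta>. v \<in> A \<and> (\<forall>x\<in>Vlevel \<beta>. x \<in> elts v \<longrightarrow> (\<exists>y\<in>Vlevel \<beta>. y \<in> elts v \<and> x \<in> elts y)) \<and> total_rel (t k) (elts v)))"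
    unfolding fGood_def
    by (simp add: sat_fTotIn[OF b] sat_fTot[OF b] cong: bex_cong ball_cong conj_cong)
  also have "\<dots> \<longleftrightarrow> (total_rel (t k) (Vlevel \<beta>) \<longrightarrow>
     (\<exists>v\<in>Vlevel \<beta> \<inter> A. (\<forall>x\<in>elts v. \<exists>y\<in>elts v. x \<in> elts y) \<and> total_rel (t k) (elts v)))"
    by (simp add: bex_Vlevel[OF b] Bex_def[of "Vlevel \<beta> \<inter> _"] cong: bex_cong conj_cong) auto
  finally show ?thesis .
qed

section \<open>The quantifier prefix and the predicate that records a winning condition\<close>

text \<open>After the last move the flag has been flipped once more, so at the end a true
  \<open>b\<close> calls for an existential quantifier. Thus the quantifier on \<open>N\<close> is
  of the same kind as the innermost move and adds no block; \<phi> and \<psi> are the matrices for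
  the two kinds.\<close>

primrec prefix_fm :: "bool \<Rightarrow> nat \<Rightarrow> nat \<Rightarrow> fm \<Rightarrow> fm \<Rightarrow> fm" where
  "prefix_fm b 0 N \<phi> \<psi> = (if b then SEx N \<psi> else SAll N \<phi>)"
| "prefix_fm b (Suc m) N \<phi> \<psi> = (if b then SAll m (prefix_fm False m N \<phi> \<psi>) else SEx m (prefix_fm True m N \<phi> \<psi>))"

lemma prefix_fm_prenex: "first_order \<phi> \<Longrightarrow> first_order \<psi> \<Longrightarrow> prenex b (Suc m) (prefix_fm b (Suc m) N \<phi> \<psi>)"
proof (induction m arbitrary: b)
  case 0
  then show ?case unfolding prenex_def by (auto intro: Pi1_Sigma1.intros)
next
  case (Suc m)
  show ?case using Suc.IH[OF Suc.prems, of "\<not> b"]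
    unfolding prenex_def prefix_fm.simps(2)[of _ "Suc m"]
    by (cases b) (simp_all del: prefix_fm.simps add: Pi1_Sigma1.intros)
qed

lemma prefix_fm_free1: "free1 (prefix_fm b m N \<phi> \<psi>) \<subseteq> free1 \<phi> \<union> free1 \<psi>"
  by (induction m arbitrary: b) auto

lemma prefix_fm_free2: "free2 (prefix_fm b m N \<phi> \<psi>) \<subseteq> (free2 \<phi> \<union> free2 \<psi>) - ({N} \<union> {..<m})"
proof (induction m arbitrary: b)
  case (Suc m)
  show ?case using Suc.IH[of "\<not> b"] by (cases b) (auto simp: less_Suc_eq)
qed auto

lemma sat_prefix_fm:
  "sat M A s t (prefix_fm b m N \<phi> \<psi>) \<longleftrightarrow>
   game b m M (\<lambda>t. sat M A s t (prefix_fm (if even m then b else \<not> b) 0 N \<phi> \<psi>)) t"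
proof (induction m arbitrary: b t)
  case (Suc m)
  show ?case using Suc.IH[where b = "\<not> b"] by (cases b; cases "even m") (simp_all add: fun_upd_def)
qed simp

text \<open>Hides the coordinates from m on from a winning condition; the auxiliary total relation
  is stored at coordinate m.\<close>

definition trunc :: "nat \<Rightarrow> (nat \<Rightarrow> 'v set) \<Rightarrow> nat \<Rightarrow> 'v set" where
  "trunc m U = (\<lambda>i. if i < m then U i else {})"

text \<open>\<open>level_code \<alpha> U\<close> codes the level $V_\alpha$, which is its only element containing all
  the others, together with a finite sequence of subsets of $V_\alpha$.\<close>

definition level_code :: "'v::zfc_universe \<Rightarrow> (nat \<Rightarrow> 'v set) \<Rightarrow> 'v" where
  "level_code \<alpha> U = mk_set (insert (level \<alpha>) {kpair (vnum i) x | i x. x \<in> U i})"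

text \<open>An oracle for \<open>R\<close> below \<delta>: the codes of the positions at which
  \<open>R\<close> holds. The bare limit levels are added so that \<open>fGood\<close> finds closure
  points whatever \<open>R\<close> is.\<close>

definition params :: "'v::zfc_universe \<Rightarrow> nat \<Rightarrow> ('v \<Rightarrow> (nat \<Rightarrow> 'v set) \<Rightarrow> bool) \<Rightarrow> 'v set" where
  "params \<delta> m R =
     {level_code \<alpha> U | \<alpha> U. \<alpha> \<in> elts \<delta> \<and> limit_level \<alpha> \<and> (\<forall>i. U i \<subseteq> Vlevel \<alpha>) \<and> (\<forall>i\<ge>m. U i = {}) \<and> R \<alpha> U} \<union>
     {level \<alpha> | \<alpha>. \<alpha> \<in> elts \<delta> \<and> limit_level \<alpha>}"

lemma level_code_code:
  assumes b: "limit_level \<beta>" "\<alpha> \<in> elts \<beta>" "limit_level \<alpha>" "\<And>i. U i \<subseteq> Vlevel \<alpha>"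
  shows "elts (level_code \<alpha> U) = insert (level \<alpha>) {kpair (vnum i) x | i x. x \<in> U i}" "level_code \<alpha> U \<in> Vlevel \<beta>"
proof -
  obtain \<xi> where xi: "\<xi> \<in> elts \<beta>" "level \<alpha> \<in> Vlevel \<xi>"
    using limit_level_below[OF b(1) level_mem[OF b(2)]] by auto
  have "ordinal \<xi>" using xi limit_level_ordinal[OF b(1)] ordinal_mem by auto
  then have "Vlevel \<alpha> \<subseteq> Vlevel \<xi>" using Vlevel_trans[OF _ xi(2)] by auto
  moreover have "kpair (vnum i) x \<in> Vlevel \<alpha>" if "x \<in> U i" for i x
    using limit_level_kpair[OF b(3) limit_level_vnum[OF b(3)]] b(4) that by auto
  ultimately have sub: "insert (level \<alpha>) {kpair (vnum i) x | i x. x \<in> U i} \<subseteq> elts (level \<xi>)"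
    using xi by auto
  show 1: "elts (level_code \<alpha> U) = insert (level \<alpha>) {kpair (vnum i) x | i x. x \<in> U i}"
    unfolding level_code_def by (rule elts_mk_set[OF sub])
  show "level_code \<alpha> U \<in> Vlevel \<beta>"
    by (rule VlevelI[OF xi(1)]) (use sub 1 in simp)
qed

lemma params_subset: "limit_level \<delta> \<Longrightarrow> params \<delta> m R \<subseteq> Vlevel \<delta>"
  unfolding params_def using level_code_code(2) level_mem by auto

text \<open>One predicate serves every \<beta> up to \<delta>, because a code belongs to V_\<beta>
  exactly if its level lies below \<beta>.\<close>

lemma sat_fMatch_params:
  assumes d: "limit_level \<delta>" and b: "limit_level \<beta>" "\<beta> = \<delta> \<or> \<beta> \<in> elts \<delta>"
  shows "sat (Vlevel \<beta>) (params \<delta> m R \<inter> Vlevel \<beta>) s t (fMatch m F) \<longleftrightarrow>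
    (\<exists>\<alpha>\<in>elts \<beta>. limit_level \<alpha> \<and> total_rel (t F) (Vlevel \<alpha>) \<and> R \<alpha> (restr \<alpha> (trunc m t)))" (is "?L \<longleftrightarrow> ?R")
proof
  note od = limit_level_ordinal[OF d] and ob = limit_level_ordinal[OF b(1)]
  assume ?L
  then obtain w v where w: "w \<in> Vlevel \<beta>" "w \<in> params \<delta> m R" and v: "v \<in> elts w"
      "\<forall>z\<in>elts w. z = v \<or> z \<in> elts v" "total_rel (t F) (elts v)"
      "\<forall>i<m. \<forall>x\<in>elts v. x \<in> t i \<longleftrightarrow> kpair (vnum i) x \<in> elts w"
    unfolding sat_fMatch[OF b(1)] by auto
  from w(2) consider (code) \<alpha> U where "w = level_code \<alpha> U" "\<alpha> \<in> elts \<delta>" "limit_level \<alpha>" "\<forall>i. U i \<subseteq> Vlevel \<alpha>"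
      "\<forall>i\<ge>m. U i = {}" "R \<alpha> U" | (level) \<alpha> where "w = level \<alpha>" "limit_level \<alpha>"
    unfolding params_def by auto
  then show ?R
  proof cases
    case code
    have ew: "elts w = insert (level \<alpha>) {kpair (vnum i) x | i x. x \<in> U i}"
      unfolding code(1) by (rule level_code_code(1)[OF d code(2,3)]) (use code(4) in auto)
    have kV: "kpair (vnum i) x \<in> Vlevel \<alpha>" if "x \<in> U i" for i x
      using limit_level_kpair[OF code(3) limit_level_vnum[OF code(3)]] code(4) that by auto
    \<comment> \<open>All other members of the code are pairs inside the level, so a different v
      would be an element of the level and also contain it.\<close>
    have "v = level \<alpha>"
    proof (rule ccontr)
      assume n: "v \<noteq> level \<alpha>"
      then have "v \<in> elts (level \<alpha>)" using v(1) ew kV by auto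
      moreover have "level \<alpha> \<in> elts v" using v(2) ew n by auto
      ultimately show False using mem_asym[of v "level \<alpha>"] by auto
    qed
    then have ev: "elts v = Vlevel \<alpha>" by simp
    have "level \<alpha> \<in> Vlevel \<beta>" using Vlevel_trans[OF ob w(1)] ew by auto
    then have ab: "\<alpha> \<in> elts \<beta>" using level_in_Vlevel_iff[OF limit_level_ordinal[OF code(3)] ob] by simp
    \<comment> \<open>The slices are read off w, where the level itself must not be mistaken for a
      tagged pair.\<close>
    have nl: "kpair (vnum i) x \<noteq> level \<alpha>" if "x \<in> Vlevel \<alpha>" for i x
      using limit_level_kpair[OF code(3) limit_level_vnum[OF code(3)] that, of i] mem_irrefl[of "level \<alpha>"] by auto
    have "U i = restr \<alpha> (trunc m t) i" for i
    proof (cases "i < m")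
      case True
      have "x \<in> t i \<longleftrightarrow> x \<in> U i" if "x \<in> Vlevel \<alpha>" for x
        using v(4) True that nl[OF that] unfolding ev ew by auto
      then show ?thesis using True code(4) unfolding restr_def trunc_def by auto
    next
      case False
      then show ?thesis using code(5) unfolding restr_def trunc_def by auto
    qed
    then have "U = restr \<alpha> (trunc m t)" by auto
    then show ?R using ab code(3,6) v(3) ev by auto
  next
    case level
    have vV: "v \<in> Vlevel \<alpha>" using v(1) level by simp
    \<comment> \<open>A bare level cannot pose as a code: it has no greatest member, since with v it
      also contains {v}.\<close>
    then have "upair v v \<in> elts w" using limit_level_upair[OF level(2)] level by simp
    then have "upair v v = v \<or> upair v v \<in> elts v" using v(2) by auto
    then show ?R
    proof
      assume "upair v v = v"
      then have "v \<in> elts v" using elts_upair[of v v] by simp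
      then show ?R using mem_irrefl[of v] by simp
    next
      assume "upair v v \<in> elts v"
      then show ?R using mem_asym[of "upair v v" v] by simp
    qed
  qed
next
  assume ?R
  then obtain \<alpha> where a: "\<alpha> \<in> elts \<beta>" "limit_level \<alpha>" "total_rel (t F) (Vlevel \<alpha>)" "R \<alpha> (restr \<alpha> (trunc m t))"
    by auto
  have ad: "\<alpha> \<in> elts \<delta>" using b a ordinal_trans[OF limit_level_ordinal[OF d]] by auto
  define U where "U = restr \<alpha> (trunc m t)"
  have U: "U i \<subseteq> Vlevel \<alpha>" for i unfolding U_def restr_def by auto
  note w = level_code_code[OF b(1) a(1,2) U]
  have "level_code \<alpha> U \<in> params \<delta> m R"
    unfolding params_def using ad a U unfolding U_def restr_def trunc_def by fastforce
  moreover have "\<forall>z\<in>elts (level_code \<alpha> U). z = level \<alpha> \<or> z \<in> elts (level \<alpha>)"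
    using limit_level_kpair[OF a(2) limit_level_vnum[OF a(2)]] U unfolding w(1) by auto
  moreover have "\<forall>i<m. \<forall>x\<in>elts (level \<alpha>). x \<in> t i \<longleftrightarrow> kpair (vnum i) x \<in> elts (level_code \<alpha> U)"
  proof (intro allI impI ballI)
    fix i x assume i: "i < m" and x: "x \<in> elts (level \<alpha>)"
    have "kpair (vnum i) x \<noteq> level \<alpha>"
      using limit_level_kpair[OF a(2) limit_level_vnum[OF a(2)], of x i] x mem_irrefl[of "level \<alpha>"] by auto
    then show "x \<in> t i \<longleftrightarrow> kpair (vnum i) x \<in> elts (level_code \<alpha> U)"
      unfolding w(1) using i x by (auto simp: U_def restr_def trunc_def)
  qed
  moreover have "level \<alpha> \<in> elts (level_code \<alpha> U)" unfolding w(1) by simp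
  moreover have "total_rel (t F) (elts (level \<alpha>))" using a(3) by simp
  ultimately show ?L unfolding sat_fMatch[OF b(1)]
    by (intro rev_bexI[of "level_code \<alpha> U"] conjI rev_bexI[of "level \<alpha>"] IntI w(2)) assumption+
qed

lemma sat_fGood_params:
  assumes d: "limit_level \<delta>" and b: "limit_level \<beta>" "\<beta> = \<delta> \<or> \<beta> \<in> elts \<delta>"
  shows "sat (Vlevel \<beta>) (params \<delta> m R \<inter> Vlevel \<beta>) s t (fGood k) \<longleftrightarrow>
    (total_rel (t k) (Vlevel \<beta>) \<longrightarrow> (\<exists>\<alpha>\<in>elts \<beta>. limit_level \<alpha> \<and> total_rel (t k) (Vlevel \<alpha>)))"
proof -
  note od = limit_level_ordinal[OF d] and ob = limit_level_ordinal[OF b(1)]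
  have "(\<exists>v\<in>Vlevel \<beta> \<inter> params \<delta> m R. (\<forall>x\<in>elts v. \<exists>y\<in>elts v. x \<in> elts y) \<and> total_rel (t k) (elts v)) \<longleftrightarrow>
    (\<exists>\<alpha>\<in>elts \<beta>. limit_level \<alpha> \<and> total_rel (t k) (Vlevel \<alpha>))" (is "?L \<longleftrightarrow> ?R")
  proof
    assume ?L
    then obtain v where v: "v \<in> Vlevel \<beta>" "v \<in> params \<delta> m R" "\<forall>x\<in>elts v. \<exists>y\<in>elts v. x \<in> elts y"
      "total_rel (t k) (elts v)" by auto
    from v(2) consider (code) \<alpha> U where "v = level_code \<alpha> U" "\<alpha> \<in> elts \<delta>" "limit_level \<alpha>" "\<forall>i. U i \<subseteq> Vlevel \<alpha>"
      | (level) \<alpha> where "v = level \<alpha>" "limit_level \<alpha>"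
      unfolding params_def by auto
    then show ?R
    proof cases
      case code
      have ew: "elts v = insert (level \<alpha>) {kpair (vnum i) x | i x. x \<in> U i}"
        unfolding code(1) by (rule level_code_code(1)[OF d code(2,3)]) (use code(4) in auto)
      have kV: "kpair (vnum i) x \<in> Vlevel \<alpha>" if "x \<in> U i" for i x
        using limit_level_kpair[OF code(3) limit_level_vnum[OF code(3)]] code(4) that by auto
      \<comment> \<open>No member of a code contains its level, so a code violates the limit
        clause.\<close>
      have "level \<alpha> \<in> elts v" using ew by simp
      then obtain y where y: "y \<in> elts v" "level \<alpha> \<in> elts y" using v(3) by auto
      have "y = level \<alpha> \<or> y \<in> elts (level \<alpha>)" using y(1) ew kV by auto
      then show ?R using y(2) mem_irrefl[of "level \<alpha>"] mem_asym[of y "level \<alpha>"] by auto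
    next
      case level
      then have "\<alpha> \<in> elts \<beta>" using v(1) level_in_Vlevel_iff[OF limit_level_ordinal[OF level(2)] ob] by simp
      then show ?R using level v(4) by auto
    qed
  next
    assume ?R
    then obtain \<alpha> where a: "\<alpha> \<in> elts \<beta>" "limit_level \<alpha>" "total_rel (t k) (Vlevel \<alpha>)" by auto
    have "\<alpha> \<in> elts \<delta>" using b a ordinal_trans[OF od] by auto
    then have "level \<alpha> \<in> params \<delta> m R" unfolding params_def using a by auto
    moreover have "level \<alpha> \<in> Vlevel \<beta>" using level_mem a by auto
    moreover have "\<forall>x\<in>elts (level \<alpha>). \<exists>y\<in>elts (level \<alpha>). x \<in> elts y" using a(2) unfolding limit_level_def by simp
    ultimately show ?L using a(3) by (intro bexI[of _ "level \<alpha>"]) auto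
  qed
  then show ?thesis unfolding sat_fGood[OF b(1)] by (simp add: Int_assoc Int_commute inf_left_commute)
qed

text \<open>Matrix for a universally quantified relation; \<open>fE\<close> is the one for an
  existentially quantified relation. Both contain \<open>fLim\<close> and \<open>fGood\<close>, so
  that truth at a level certifies the level before the equivalence with \<open>R\<close> is invoked
  there.\<close>

definition fA :: "nat \<Rightarrow> fm" where
  "fA k = Conj fLim (Conj (fGood k) (fImp (fTot (SMem 7 (Suc k))) (fMatch (Suc k) (Suc k))))"

definition fE :: "nat \<Rightarrow> fm" where
  "fE k = Conj fLim (Conj (fGood k) (Conj (fTot (SMem 7 (Suc k))) (Neg (fMatch (Suc k) (Suc k)))))"

lemma fAE_syntax:
  "free1 (fA k) = {}" "free2 (fA k) \<subseteq> {..Suc k}" "first_order (fA k)"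
  "free1 (fE k) = {}" "free2 (fE k) \<subseteq> {..Suc k}" "first_order (fE k)"
  unfolding fA_def fE_def fTot_def by auto

definition fUniv :: "nat \<Rightarrow> fm" where
  "fUniv k = prefix_fm True (Suc k) (Suc k) (fA k) (fE k)"

lemma fUniv_Pi1: "Pi1 (Suc k) (fUniv k)"
  unfolding fUniv_def using prefix_fm_prenex[of "fA k" "fE k" True k "Suc k"] fAE_syntax by (simp add: prenex_def)

lemma fUniv_sentence: "sentence (fUniv k)"
  unfolding sentence_def fUniv_def
  using prefix_fm_free1[of True "Suc k" "Suc k" "fA k" "fE k"] prefix_fm_free2[of True "Suc k" "Suc k" "fA k" "fE k"]
    fAE_syntax[of k] by fastforce

text \<open>For odd \<open>k\<close> the innermost move is existential, and \<open>R\<close> is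
  expressed as: for some total relation, no closure point satisfies the negation of
  \<open>R\<close>. This negates the universal form for the negation of \<open>R\<close>, whose
  oracle is therefore supplied.\<close>

definition univ_param :: "'v::zfc_universe \<Rightarrow> nat \<Rightarrow> ('v \<Rightarrow> (nat \<Rightarrow> 'v set) \<Rightarrow> bool) \<Rightarrow> 'v set" where
  "univ_param \<delta> k R = params \<delta> (Suc k) (if even k then R else (\<lambda>\<alpha> U. \<not> R \<alpha> U))"

definition fBase :: "nat \<Rightarrow> fm" where
  "fBase k = prefix_fm (odd k) 0 (Suc k) (fA k) (fE k)"

lemma sat_fUniv: "sat M A s t (fUniv k) \<longleftrightarrow> game True (Suc k) M (\<lambda>t. sat M A s t (fBase k)) t"
  unfolding fUniv_def fBase_def sat_prefix_fm[where m = "Suc k"] by simp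

lemma sat_fBase:
  assumes d: "limit_level \<delta>" and b: "good \<beta>" "\<beta> = \<delta> \<or> \<beta> \<in> elts \<delta>" and R: "reflective R"
    and t: "\<And>i. i < Suc k \<Longrightarrow> t i \<subseteq> Vlevel \<beta>"
  shows "sat (Vlevel \<beta>) (univ_param \<delta> k R \<inter> Vlevel \<beta>) s t (fBase k) \<longleftrightarrow> R \<beta> (trunc (Suc k) t)"
proof -
  note lb = good_limit_level[OF b(1)]
  let ?V = "Vlevel \<beta>" and ?A = "univ_param \<delta> k R \<inter> Vlevel \<beta>" and ?T = "trunc (Suc k) t"
  have lim: "sat ?V ?A s t' fLim" for t' using sat_fLim[OF limit_level_ordinal[OF lb]] lb by blast
  have gd: "sat ?V ?A s t' (fGood k)" for t'
    unfolding univ_param_def sat_fGood_params[OF d lb b(2)]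
    using goodD[OF b(1) eventually_below_total_rel] by blast
  have total_rel: "sat ?V ?A s (t(Suc k := F)) (fTot (SMem 7 (Suc k))) \<longleftrightarrow> total_rel F ?V" for F
    unfolding sat_fTot[OF lb] by simp
  have tr: "trunc (Suc k) (t(Suc k := F)) = ?T" for F by (rule ext) (simp add: trunc_def)
  have T: "?T i \<subseteq> ?V" for i using t unfolding trunc_def by auto
  show ?thesis
  proof (cases "even k")
    case True
    then have "sat ?V ?A s t (fBase k) \<longleftrightarrow> (\<forall>F. F \<subseteq> ?V \<longrightarrow> total_rel F ?V \<longrightarrow>
        sat ?V ?A s (t(Suc k := F)) (fMatch (Suc k) (Suc k)))"
      using lim gd total_rel unfolding fBase_def fA_def by auto
    also have "\<dots> \<longleftrightarrow> R \<beta> ?T"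
      unfolding univ_param_def sat_fMatch_params[OF d lb b(2)] reflective_iff_all_total_rel[OF b(1) R, of ?T, OF T]
      using True by (simp add: tr)
    finally show ?thesis .
  next
    case False
    then have "sat ?V ?A s t (fBase k) \<longleftrightarrow> \<not> (\<forall>F. F \<subseteq> ?V \<longrightarrow> total_rel F ?V \<longrightarrow>
        sat ?V ?A s (t(Suc k := F)) (fMatch (Suc k) (Suc k)))"
      using lim gd total_rel unfolding fBase_def fE_def by auto
    also have "\<dots> \<longleftrightarrow> \<not> \<not> R \<beta> ?T"
      unfolding univ_param_def sat_fMatch_params[OF d lb b(2)]
        reflective_iff_all_total_rel[OF b(1) reflective_Not[OF R], of ?T, OF T]
      using False by (simp add: tr)
    finally show ?thesis by simp
  qed
qed

text \<open>For use at a reflected level before it is known to be good, hence before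
  \<open>sat_fBase\<close> applies. One value of the relation is enough: the empty set in the
  universal case, the witness in the existential case.\<close>

lemma sat_fBaseD:
  assumes "sat M A s t (fBase k)"
  shows "\<exists>t'. t' k = t k \<and> sat M A s t' fLim \<and> sat M A s t' (fGood k)"
proof -
  have "\<exists>B. sat M A s (t(Suc k := B)) fLim \<and> sat M A s (t(Suc k := B)) (fGood k)"
  proof (cases "even k")
    case True
    then have "\<forall>B. B \<subseteq> M \<longrightarrow> sat M A s (t(Suc k := B)) (fA k)" using assms by (simp add: fBase_def)
    then have "sat M A s (t(Suc k := {})) (fA k)" by blast
    then show ?thesis unfolding fA_def by auto
  next
    case False
    then have "\<exists>B. B \<subseteq> M \<and> sat M A s (t(Suc k := B)) (fE k)" using assms by (simp add: fBase_def)
    then show ?thesis unfolding fE_def by auto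
  qed
  then obtain B where "sat M A s (t(Suc k := B)) fLim" "sat M A s (t(Suc k := B)) (fGood k)" by auto
  then show ?thesis by (intro exI[of _ "t(Suc k := B)"]) simp
qed

section \<open>First consequences of indescribability, and reflection of games\<close>

lemma Pi1_Sigma1_mono:
  "Pi1 m \<phi> \<Longrightarrow> Pi1 (Suc m) \<phi>"
  "Sigma1 m \<phi> \<Longrightarrow> Sigma1 (Suc m) \<phi>"
  by (induction m \<phi> and m \<phi> rule: Pi1_Sigma1.inducts) (auto intro: Pi1_Sigma1.intros)

lemma indescribable_subset_Suc: "indescribable_subset (Suc m) \<delta> S \<Longrightarrow> indescribable_subset m \<delta> S"
  unfolding indescribable_subset_def using Pi1_Sigma1_mono by blast

lemma indescribable_subset_first_order:
  assumes "indescribable_subset m \<delta> S" "first_order \<phi>" "sentence \<phi>" "A \<subseteq> Vlevel \<delta>"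
    "sat (Vlevel \<delta>) A s t \<phi>"
  shows "\<exists>\<alpha>\<in>S. sat (Vlevel \<alpha>) (A \<inter> Vlevel \<alpha>) s t \<phi>"
proof -
  have "indescribable_subset 0 \<delta> S"
    using assms(1) by (induction m) (auto dest: indescribable_subset_Suc)
  moreover have "Pi1 0 \<phi>" using assms(2) by (rule Pi1_Sigma1.intros)
  moreover have m: "models M B \<phi> \<longleftrightarrow> sat M B s t \<phi>" for M B
    by (rule models_sentence[OF assms(3)])
  ultimately show ?thesis
    using assms(3,4,5) unfolding indescribable_subset_def m[symmetric] by blast
qed

lemma indescribable_subset_ordinal: "indescribable_subset m \<delta> S \<Longrightarrow> ordinal \<delta>"
  unfolding indescribable_subset_def cardinal_def by auto

lemma indescribable_subset_subset: "indescribable_subset m \<delta> S \<Longrightarrow> S \<subseteq> elts \<delta>"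
  unfolding indescribable_subset_def by auto

text \<open>With {x} as predicate, the sentence that the predicate is nonempty reflects only to
  \<alpha> with x in V_\<alpha>, and then V_\<alpha> is an element of V_\<delta> that contains x. A
  valid sentence has to reflect as well, so V_\<delta> is nonempty.\<close>

lemma indescribable_subset_limit_level:
  assumes S: "indescribable_subset m \<delta> S"
  shows "limit_level \<delta>"
proof -
  note S' = indescribable_subset_subset[OF S]
  have "\<exists>\<alpha>\<in>S. sat (Vlevel \<alpha>) ({} \<inter> Vlevel \<alpha>) (\<lambda>_. undefined) (\<lambda>_. {}) (All 0 (Eq 0 0))"
    by (rule indescribable_subset_first_order[OF S]) (auto simp: sentence_def)
  then obtain \<alpha> where "\<alpha> \<in> elts \<delta>" using S' by auto
  then have ne: "Vlevel \<delta> \<noteq> {}" using level_mem by auto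
  have "\<exists>y\<in>Vlevel \<delta>. x \<in> elts y" if x: "x \<in> Vlevel \<delta>" for x
  proof -
    have "\<exists>\<alpha>\<in>S. sat (Vlevel \<alpha>) ({x} \<inter> Vlevel \<alpha>) (\<lambda>_. undefined) (\<lambda>_. {}) (fEx 0 (InA 0))"
      by (rule indescribable_subset_first_order[OF S]) (use x in \<open>auto simp: sentence_def\<close>)
    then obtain \<alpha> where "\<alpha> \<in> elts \<delta>" "x \<in> Vlevel \<alpha>" using S' by auto
    then show ?thesis using level_mem[of \<alpha> \<delta>] by (intro bexI[of _ "level \<alpha>"]) auto
  qed
  then show ?thesis unfolding limit_level_def using ne indescribable_subset_ordinal[OF S] by auto
qed

text \<open>Totality of the predicate \<open>F\<close> is first-order and so reflects. The conjunct
  \<open>fLim\<close> excludes degenerate \<alpha> such as 0, where totality is vacuous.\<close>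

lemma indescribable_subset_good:
  assumes S: "indescribable_subset m \<delta> S"
  shows "good \<delta>"
proof (rule goodI)
  show l: "limit_level \<delta>" by (rule indescribable_subset_limit_level[OF S])
  fix F assume F: "F \<subseteq> Vlevel \<delta>" "total_rel F (Vlevel \<delta>)"
  let ?s = "\<lambda>_. undefined" and ?t = "\<lambda>_. {}"
  have "\<exists>\<alpha>\<in>S. sat (Vlevel \<alpha>) (F \<inter> Vlevel \<alpha>) ?s ?t (Conj fLim (fTot (InA 7)))"
  proof (rule indescribable_subset_first_order[OF S])
    show "sat (Vlevel \<delta>) F ?s ?t (Conj fLim (fTot (InA 7)))"
      using l F(2) sat_fTot(2)[OF l] sat_fLim[OF limit_level_ordinal[OF l]] by auto
  qed (use F in \<open>auto simp: sentence_def fTot_def\<close>)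
  then obtain \<alpha> where a: "\<alpha> \<in> S" "sat (Vlevel \<alpha>) (F \<inter> Vlevel \<alpha>) ?s ?t (Conj fLim (fTot (InA 7)))"
    by auto
  have ad: "\<alpha> \<in> elts \<delta>" using a indescribable_subset_subset[OF S] by auto
  have oa: "ordinal \<alpha>" using ordinal_mem[OF limit_level_ordinal[OF l] ad] .
  have la: "limit_level \<alpha>" using a(2) sat_fLim[OF oa] by auto
  have "total_rel (F \<inter> Vlevel \<alpha>) (Vlevel \<alpha>)" using a(2) sat_fTot(2)[OF la] by auto
  then have "total_rel F (Vlevel \<alpha>)" unfolding total_rel_def by auto
  then show "\<exists>\<alpha>\<in>elts \<delta>. limit_level \<alpha> \<and> total_rel F (Vlevel \<alpha>)" using ad la by auto
qed

text \<open>Via the universal formula, indescribability gives reflection for games with an arbitrary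
  reflective winning condition.\<close>

lemma indescribable_subset_game:
  assumes S: "indescribable_subset (Suc k) \<delta> S" and R: "reflective R"
    and g: "game True (Suc k) (Vlevel \<delta>) (R \<delta>) (\<lambda>_. {})"
  shows "\<exists>\<beta>\<in>S. good \<beta> \<and> game True (Suc k) (Vlevel \<beta>) (R \<beta>) (\<lambda>_. {})"
proof -
  note l = indescribable_subset_limit_level[OF S] and gd = indescribable_subset_good[OF S]
  let ?A = "univ_param \<delta> k R" and ?s = "\<lambda>_. undefined" and ?t = "\<lambda>_. {}"
  have A: "?A \<subseteq> Vlevel \<delta>" unfolding univ_param_def by (rule params_subset[OF l])
  have eq: "sat (Vlevel \<beta>) (?A \<inter> Vlevel \<beta>) ?s ?t (fUniv k) \<longleftrightarrow>
      game True (Suc k) (Vlevel \<beta>) (R \<beta>) (\<lambda>_. {})" if b: "good \<beta>" "\<beta> = \<delta> \<or> \<beta> \<in> elts \<delta>" for \<beta>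
    unfolding sat_fUniv
  proof (rule game_cong)
    fix U' :: "nat \<Rightarrow> 'a set"
    assume U': "\<And>i. i \<ge> Suc k \<Longrightarrow> U' i = {}" "\<And>i. i < Suc k \<Longrightarrow> U' i \<subseteq> Vlevel \<beta>"
    have "trunc (Suc k) U' = U'" using U'(1) by (intro ext) (simp add: trunc_def not_less)
    then show "sat (Vlevel \<beta>) (?A \<inter> Vlevel \<beta>) ?s U' (fBase k) \<longleftrightarrow> R \<beta> U'"
      using sat_fBase[OF l b R U'(2)] by simp
  qed
  have "sat (Vlevel \<delta>) ?A ?s ?t (fUniv k)" using eq[OF gd] g A by (simp add: Int_absorb2)
  then have "models (Vlevel \<delta>) ?A (fUniv k)" using models_sentence[OF fUniv_sentence] by blast
  then obtain \<beta> where b: "\<beta> \<in> S" "models (Vlevel \<beta>) (?A \<inter> Vlevel \<beta>) (fUniv k)"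
    using S A fUniv_Pi1 fUniv_sentence unfolding indescribable_subset_def by blast
  then have sb: "sat (Vlevel \<beta>) (?A \<inter> Vlevel \<beta>) ?s ?t (fUniv k)"
    unfolding models_def by auto
  have bd: "\<beta> \<in> elts \<delta>" using b indescribable_subset_subset[OF S] by auto
  note ob = ordinal_mem[OF limit_level_ordinal[OF l] bd]
  \<comment> \<open>\<open>eq\<close> presupposes a good \<beta>, so goodness is extracted from the
    formula. The opening move is universal and may be any F; some play that opens with F ends where
    \<open>fBase\<close> holds, with F still at coordinate \<open>k\<close>, which is the one that
    \<open>fGood\<close> tests.\<close>
  have leaf: "\<exists>t'. t' k = F \<and> sat (Vlevel \<beta>) (?A \<inter> Vlevel \<beta>) ?s t' fLim \<and>
      sat (Vlevel \<beta>) (?A \<inter> Vlevel \<beta>) ?s t' (fGood k)" if F: "F \<subseteq> Vlevel \<beta>" for F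
  proof -
    have "game False k (Vlevel \<beta>) (\<lambda>t. sat (Vlevel \<beta>) (?A \<inter> Vlevel \<beta>) ?s t (fBase k)) (?t(k := F))"
      using sb F unfolding sat_fUniv by simp
    from game_leaf[OF this] obtain U' where U': "\<forall>i\<ge>k. U' i = (?t(k := F)) i"
      "sat (Vlevel \<beta>) (?A \<inter> Vlevel \<beta>) ?s U' (fBase k)" by blast
    have "U' k = F" using U'(1) by simp
    then show ?thesis using sat_fBaseD[OF U'(2)] by simp
  qed
  have lb: "limit_level \<beta>" using leaf[of "{}"] sat_fLim[OF ob] by blast
  have "good \<beta>"
  proof (rule goodI[OF lb])
    fix F assume F: "F \<subseteq> Vlevel \<beta>" "total_rel F (Vlevel \<beta>)"
    obtain t' where t': "t' k = F" "sat (Vlevel \<beta>) (?A \<inter> Vlevel \<beta>) ?s t' (fGood k)"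
      using leaf[OF F(1)] by auto
    show "\<exists>\<alpha>\<in>elts \<beta>. limit_level \<alpha> \<and> total_rel F (Vlevel \<alpha>)"
      using t'(2)[unfolded univ_param_def sat_fGood_params[OF l lb disjI2[OF bd]]] F(2) t'(1) by simp
  qed
  then show ?thesis using b eq[of \<beta>] sb bd by auto
qed

subsection \<open>The indescribability filter\<close>

instance fm :: countable
  by countable_datatype

text \<open>The filter dual to Pi^1_m-indescribability, generated by games with reflective
  conditions instead of formulas with parameters. It contains the usual generators by
  \<open>large_models\<close>, and for positive m every indescribable set is positive for it by
  \<open>large_meets\<close>.\<close>

definition large :: "nat \<Rightarrow> 'v::zfc_universe \<Rightarrow> 'v set \<Rightarrow> bool" where
  "large m \<delta> T \<longleftrightarrow> (\<exists>R. reflective R \<and> game True m (Vlevel \<delta>) (R \<delta>) (\<lambda>_. {}) \<and>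
     (\<forall>\<beta>\<in>elts \<delta>. good \<beta> \<and> game True m (Vlevel \<beta>) (R \<beta>) (\<lambda>_. {}) \<longrightarrow> \<beta> \<in> T))"

lemma large_mono: "large m \<delta> T \<Longrightarrow> (\<And>\<beta>. \<beta> \<in> elts \<delta> \<Longrightarrow> good \<beta> \<Longrightarrow> \<beta> \<in> T \<Longrightarrow> \<beta> \<in> T') \<Longrightarrow> large m \<delta> T'"
  unfolding large_def by metis

lemma reflective_const: "reflective (\<lambda>_ _. c)"
  unfolding reflective_def by (auto intro: eventually_below_all)

lemma large_UNIV: "large m \<delta> UNIV"
  unfolding large_def by (intro exI[of _ "\<lambda>_ _. True"]) (simp add: reflective_const game_const)

lemma large_meets:
  assumes "indescribable_subset (Suc k) \<delta> S" "large (Suc k) \<delta> T"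
  shows "\<exists>\<beta>\<in>S. good \<beta> \<and> \<beta> \<in> T"
proof -
  obtain R where R: "reflective R" "game True (Suc k) (Vlevel \<delta>) (R \<delta>) (\<lambda>_. {})"
    "\<forall>\<beta>\<in>elts \<delta>. good \<beta> \<and> game True (Suc k) (Vlevel \<beta>) (R \<beta>) (\<lambda>_. {}) \<longrightarrow> \<beta> \<in> T"
    using assms(2) unfolding large_def by blast
  show ?thesis
    using indescribable_subset_game[OF assms(1) R(1,2)] R(3) indescribable_subset_subset[OF assms(1)] by blast
qed

lemma slice_restr:
  assumes "limit_level \<beta>" "\<alpha> \<in> elts \<beta>" "limit_level \<alpha>"
  shows "slice (Vlevel \<alpha>) (B \<inter> Vlevel \<alpha>) i = slice (Vlevel \<beta>) B i \<inter> Vlevel \<alpha>"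
  using limit_level_kpair[OF assms(3) limit_level_vnum[OF assms(3)]] Vlevel_mono[OF limit_level_ordinal[OF assms(1)] assms(2)]
  unfolding slice_def by auto

text \<open>In a diagonal intersection the index $\gamma$ is absorbed into the first set quantifier: the
  set chosen first codes a singleton $\{\gamma\}$ besides the first move in the game for $\gamma$.\<close>

definition diag :: "nat \<Rightarrow> ('v::zfc_universe \<Rightarrow> 'v \<Rightarrow> (nat \<Rightarrow> 'v set) \<Rightarrow> bool) \<Rightarrow> 'v \<Rightarrow> (nat \<Rightarrow> 'v set) \<Rightarrow> bool" where
  "diag k R \<beta> U \<longleftrightarrow> (\<forall>\<gamma>. slice (Vlevel \<beta>) (U k) 0 = {\<gamma>} \<longrightarrow>
     R \<gamma> \<beta> (U(k := slice (Vlevel \<beta>) (U k) 1)))"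

lemma restr_upd: "restr \<alpha> (U(k := B)) = (restr \<alpha> U)(k := B \<inter> Vlevel \<alpha>)"
  by (rule ext) (simp add: restr_def)

text \<open>That the slice is empty is inherited by all \<alpha>; that it is {\<gamma>}, or has two
  members, is visible at every \<alpha> whose level contains these one or two elements. In the
  singleton case \<gamma> is now fixed and \<open>R \<gamma>\<close> reflects.\<close>

lemma reflective_diag:
  assumes R: "\<And>\<gamma>. reflective (R \<gamma>)"
  shows "reflective (diag k R)"
  unfolding reflective_def
proof (intro allI impI)
  fix \<beta> :: 'a and U :: "nat \<Rightarrow> 'a set"
  assume bU: "limit_level \<beta> \<and> (\<forall>i. U i \<subseteq> Vlevel \<beta>)"
  then have b: "limit_level \<beta>" by auto
  let ?S = "slice (Vlevel \<beta>) (U k)"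
  have sV: "?S i \<subseteq> Vlevel \<beta>" for i unfolding slice_def by auto
  have sl: "slice (Vlevel \<alpha>) (restr \<alpha> U k) i = ?S i \<inter> Vlevel \<alpha>" if "\<alpha> \<in> elts \<beta>" "limit_level \<alpha>" for \<alpha> i
    unfolding restr_def using slice_restr[OF b that] .
  consider (1) \<gamma> where "?S 0 = {\<gamma>}" | (0) "?S 0 = {}" | (2) x y where "x \<in> ?S 0" "y \<in> ?S 0" "x \<noteq> y"
    by (cases "?S 0 = {}") auto
  then show "eventually_below \<beta> (\<lambda>\<alpha>. diag k R \<alpha> (restr \<alpha> U) \<longleftrightarrow> diag k R \<beta> U)"
  proof cases
    case 1
    let ?U = "U(k := ?S 1)"
    have g: "\<gamma> \<in> Vlevel \<beta>" using 1 sV[of 0] by auto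
    have e: "eventually_below \<beta> (\<lambda>\<alpha>. R \<gamma> \<alpha> (restr \<alpha> ?U) \<longleftrightarrow> R \<gamma> \<beta> ?U)"
      by (rule reflectiveD[OF R b]) (use bU sV in auto)
    show ?thesis
    proof (rule eventually_below_mono[OF eventually_below_conj[OF b eventually_below_mem[OF g] e]])
      fix \<alpha> assume a: "\<alpha> \<in> elts \<beta>" "limit_level \<alpha>" "\<gamma> \<in> Vlevel \<alpha> \<and> (R \<gamma> \<alpha> (restr \<alpha> ?U) \<longleftrightarrow> R \<gamma> \<beta> ?U)"
      have "restr \<alpha> ?U = (restr \<alpha> U)(k := slice (Vlevel \<alpha>) (restr \<alpha> U k) 1)"
        unfolding sl[OF a(1,2)] by (rule restr_upd)
      moreover have "slice (Vlevel \<alpha>) (restr \<alpha> U k) 0 = {\<gamma>}" using sl[OF a(1,2)] 1 a(3) by auto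
      ultimately show "diag k R \<alpha> (restr \<alpha> U) \<longleftrightarrow> diag k R \<beta> U"
        unfolding diag_def using 1 a(3) by auto
    qed
  next
    case 0
    then show ?thesis using sl unfolding diag_def by (intro eventually_below_all) auto
  next
    case 2
    have xy: "x \<in> Vlevel \<beta>" "y \<in> Vlevel \<beta>" using 2 sV[of 0] by auto
    show ?thesis
    proof (rule eventually_below_mono[OF eventually_below_conj[OF b eventually_below_mem[OF xy(1)] eventually_below_mem[OF xy(2)]]])
      fix \<alpha> assume a: "\<alpha> \<in> elts \<beta>" "limit_level \<alpha>" "x \<in> Vlevel \<alpha> \<and> y \<in> Vlevel \<alpha>"
      have "x \<in> slice (Vlevel \<alpha>) (restr \<alpha> U k) 0" "y \<in> slice (Vlevel \<alpha>) (restr \<alpha> U k) 0"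
        using sl[OF a(1,2)] 2 a(3) by auto
      then have "slice (Vlevel \<alpha>) (restr \<alpha> U k) 0 \<noteq> {\<gamma>}" "?S 0 \<noteq> {\<gamma>}" for \<gamma> using 2 by auto
      then show "diag k R \<alpha> (restr \<alpha> U) \<longleftrightarrow> diag k R \<beta> U" unfolding diag_def by auto
    qed
  qed
qed

text \<open>Opening moves coding {\<gamma>} and C amount to a choice of \<gamma> and an opening move
  C in its game, and every such pair is coded. An opening move that codes no singleton makes the
  condition true throughout.\<close>

lemma game_diag:
  assumes b: "limit_level \<beta>"
  shows "game True (Suc k) (Vlevel \<beta>) (diag k R \<beta>) (\<lambda>_. {}) \<longleftrightarrow>
    (\<forall>\<gamma>\<in>Vlevel \<beta>. game True (Suc k) (Vlevel \<beta>) (R \<gamma> \<beta>) (\<lambda>_. {}))"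
proof -
  let ?V = "Vlevel \<beta>" and ?e = "\<lambda>_::nat. {}"
  have key: "game False k ?V (diag k R \<beta>) (?e(k := B)) \<longleftrightarrow>
      game False k ?V (R \<gamma> \<beta>) (?e(k := slice ?V B 1))" if "slice ?V B 0 = {\<gamma>}" for B \<gamma>
  proof -
    have "game False k ?V (diag k R \<beta>) (?e(k := B)) \<longleftrightarrow>
        game False k ?V (\<lambda>U. R \<gamma> \<beta> (U(k := slice ?V B 1))) (?e(k := B))"
    proof (rule game_cong)
      fix U' :: "nat \<Rightarrow> 'a set"
      assume "\<And>i. i \<ge> k \<Longrightarrow> U' i = (?e(k := B)) i"
      from this[of k] have "U' k = B" by simp
      then show "diag k R \<beta> U' \<longleftrightarrow> R \<gamma> \<beta> (U'(k := slice ?V B 1))"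
        using that unfolding diag_def by auto
    qed
    also have "\<dots> \<longleftrightarrow> game False k ?V (R \<gamma> \<beta>) (?e(k := B, k := slice ?V B 1))"
      by (rule game_upd) simp
    finally show ?thesis by simp
  qed
  have triv: "game False k ?V (diag k R \<beta>) (?e(k := B))" if "\<And>\<gamma>. slice ?V B 0 \<noteq> {\<gamma>}" for B
  proof -
    have "game False k ?V (diag k R \<beta>) (?e(k := B)) \<longleftrightarrow> game False k ?V (\<lambda>_. True) (?e(k := B))"
    proof (rule game_cong)
      fix U' :: "nat \<Rightarrow> 'a set"
      assume "\<And>i. i \<ge> k \<Longrightarrow> U' i = (?e(k := B)) i"
      from this[of k] have "U' k = B" by simp
      then show "diag k R \<beta> U' \<longleftrightarrow> True" using that unfolding diag_def by auto
    qed
    then show ?thesis by (simp add: game_const)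
  qed
  have sV: "slice ?V B i \<subseteq> ?V" for B i unfolding slice_def by auto
  show ?thesis
  proof
    assume l: "game True (Suc k) ?V (diag k R \<beta>) ?e"
    show "\<forall>\<gamma>\<in>?V. game True (Suc k) ?V (R \<gamma> \<beta>) ?e"
    proof
      fix \<gamma> assume g: "\<gamma> \<in> ?V"
      have "game False k ?V (R \<gamma> \<beta>) (?e(k := C))" if C: "C \<subseteq> ?V" for C
      proof -
        have "\<exists>B. B \<subseteq> ?V \<and> slice ?V B = (\<lambda>i. if i = 0 then {\<gamma>} else C)"
          by (rule slice_surj[OF b]) (use g C in auto)
        then obtain B where B: "B \<subseteq> ?V" "slice ?V B = (\<lambda>i. if i = 0 then {\<gamma>} else C)" by auto
        then have "slice ?V B 0 = {\<gamma>}" "slice ?V B 1 = C" by auto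
        moreover have "game False k ?V (diag k R \<beta>) (?e(k := B))" using l B(1) by simp
        ultimately show ?thesis using key by simp
      qed
      then show "game True (Suc k) ?V (R \<gamma> \<beta>) ?e" by simp
    qed
  next
    assume r: "\<forall>\<gamma>\<in>?V. game True (Suc k) ?V (R \<gamma> \<beta>) ?e"
    have "game False k ?V (diag k R \<beta>) (?e(k := B))" if "B \<subseteq> ?V" for B
    proof (cases "\<exists>\<gamma>. slice ?V B 0 = {\<gamma>}")
      case True
      then obtain \<gamma> where g: "slice ?V B 0 = {\<gamma>}" by auto
      then have "\<gamma> \<in> ?V" using sV[of B 0] by auto
      then have "game False k ?V (R \<gamma> \<beta>) (?e(k := slice ?V B 1))" using r sV[of B 1] by simp
      then show ?thesis using key[OF g] by simp
    next
      case False
      then show ?thesis using triv by auto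
    qed
    then show "game True (Suc k) ?V (diag k R \<beta>) ?e" by simp
  qed
qed

text \<open>Normality. The conditions \<open>R \<gamma>\<close> are picked by choice; no
  definability of the family is at stake, because \<open>diag\<close> of any family of reflective
  conditions is reflective.\<close>

lemma large_diag:
  assumes d: "limit_level \<delta>" and T: "\<And>\<gamma>. large (Suc k) \<delta> (T \<gamma>)"
  shows "large (Suc k) \<delta> {\<beta>. \<forall>\<gamma>\<in>Vlevel \<beta>. \<beta> \<in> T \<gamma>}"
proof -
  have "\<forall>\<gamma>. \<exists>R. reflective R \<and> game True (Suc k) (Vlevel \<delta>) (R \<delta>) (\<lambda>_. {}) \<and>
     (\<forall>\<beta>\<in>elts \<delta>. good \<beta> \<and> game True (Suc k) (Vlevel \<beta>) (R \<beta>) (\<lambda>_. {}) \<longrightarrow> \<beta> \<in> T \<gamma>)"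
    using T unfolding large_def by simp
  from choice[OF this] obtain R where R: "\<And>\<gamma>. reflective (R \<gamma>)"
    "\<And>\<gamma>. game True (Suc k) (Vlevel \<delta>) (R \<gamma> \<delta>) (\<lambda>_. {})"
    "\<And>\<gamma> \<beta>. \<beta> \<in> elts \<delta> \<Longrightarrow> good \<beta> \<Longrightarrow> game True (Suc k) (Vlevel \<beta>) (R \<gamma> \<beta>) (\<lambda>_. {}) \<Longrightarrow> \<beta> \<in> T \<gamma>"
    by blast
  show ?thesis unfolding large_def
  proof (intro exI[of _ "diag k R"] conjI ballI impI)
    show "reflective (diag k R)" by (rule reflective_diag[OF R(1)])
    show "game True (Suc k) (Vlevel \<delta>) (diag k R \<delta>) (\<lambda>_. {})"
      unfolding game_diag[OF d] using R(2) by simp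
    fix \<beta> assume b: "\<beta> \<in> elts \<delta>" "good \<beta> \<and> game True (Suc k) (Vlevel \<beta>) (diag k R \<beta>) (\<lambda>_. {})"
    then have "\<forall>\<gamma>\<in>Vlevel \<beta>. game True (Suc k) (Vlevel \<beta>) (R \<gamma> \<beta>) (\<lambda>_. {})"
      using game_diag[OF good_limit_level] by blast
    then show "\<beta> \<in> {\<beta>. \<forall>\<gamma>\<in>Vlevel \<beta>. \<beta> \<in> T \<gamma>}" using R(3)[OF b(1)] b(2) by auto
  qed
qed

text \<open>Countable completeness as a case of normality: index i is moved to the numeral of i,
  which belongs to every good level.\<close>

lemma large_INT:
  fixes T :: "nat \<Rightarrow> 'v::zfc_universe set"
  assumes d: "limit_level \<delta>" and T: "\<And>i. large (Suc k) \<delta> (T i)"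
  shows "large (Suc k) \<delta> (\<Inter>i. T i)"
proof -
  define T' where "T' \<gamma> = {\<beta>. \<forall>i. \<gamma> = vnum i \<longrightarrow> \<beta> \<in> T i}" for \<gamma> :: 'v
  have "large (Suc k) \<delta> (T' \<gamma>)" for \<gamma>
  proof (cases "\<exists>i. \<gamma> = vnum i")
    case True
    then obtain i where "\<gamma> = vnum i" by auto
    then have "T' \<gamma> = T i" unfolding T'_def by auto
    then show ?thesis using T by simp
  next
    case False
    then have "T' \<gamma> = UNIV" unfolding T'_def by auto
    then show ?thesis using large_UNIV by simp
  qed
  from large_diag[where T = T', OF d this] show ?thesis
    by (rule large_mono) (use limit_level_vnum[OF good_limit_level] in \<open>auto simp: T'_def\<close>)
qed

lemma large_Int:
  assumes "limit_level \<delta>" "large (Suc k) \<delta> S" "large (Suc k) \<delta> T"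
  shows "large (Suc k) \<delta> (S \<inter> T)"
  by (rule large_mono[OF large_INT[OF assms(1), of k "\<lambda>i. if i = 0 then S else T"]])
    (use assms in \<open>auto split: if_splits\<close>)

section \<open>Sentences and indescribability itself as games\<close>

lemma reflective_sat:
  assumes \<psi>: "first_order \<psi>" "free1 \<psi> = {}"
    and A: "\<And>\<alpha> \<beta> U. limit_level \<beta> \<Longrightarrow> \<alpha> \<in> elts \<beta> \<Longrightarrow> limit_level \<alpha> \<Longrightarrow> A \<alpha> (restr \<alpha> U) = A \<beta> U \<inter> Vlevel \<alpha>"
    and t: "\<And>\<alpha> \<beta> U i. limit_level \<beta> \<Longrightarrow> \<alpha> \<in> elts \<beta> \<Longrightarrow> limit_level \<alpha> \<Longrightarrow> t \<alpha> (restr \<alpha> U) i = t \<beta> U i \<inter> Vlevel \<alpha>"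
  shows "reflective (\<lambda>\<beta> U. sat (Vlevel \<beta>) (A \<beta> U) s (t \<beta> U) \<psi>)"
  unfolding reflective_def
proof (intro allI impI, elim conjE)
  fix \<beta> :: 'a and U :: "nat \<Rightarrow> 'a set"
  assume b: "limit_level \<beta>"
  show "eventually_below \<beta> (\<lambda>\<alpha>. sat (Vlevel \<alpha>) (A \<alpha> (restr \<alpha> U)) s (t \<alpha> (restr \<alpha> U)) \<psi> \<longleftrightarrow>
      sat (Vlevel \<beta>) (A \<beta> U) s (t \<beta> U) \<psi>)"
  proof (rule eventually_below_mono[OF sat_elementary[OF b \<psi>(1), of "A \<beta> U" "t \<beta> U"]])
    fix \<alpha> assume a: "\<alpha> \<in> elts \<beta>" "limit_level \<alpha>"
      and e: "\<forall>s. (\<forall>i\<in>free1 \<psi>. s i \<in> Vlevel \<alpha>) \<longrightarrow>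
        sat (Vlevel \<alpha>) (A \<beta> U \<inter> Vlevel \<alpha>) s (restr \<alpha> (t \<beta> U)) \<psi> = sat (Vlevel \<beta>) (A \<beta> U) s (t \<beta> U) \<psi>"
    have "t \<alpha> (restr \<alpha> U) = restr \<alpha> (t \<beta> U)" unfolding restr_def[of \<alpha> "t \<beta> U"] using t[OF b a] by auto
    then show "sat (Vlevel \<alpha>) (A \<alpha> (restr \<alpha> U)) s (t \<alpha> (restr \<alpha> U)) \<psi> \<longleftrightarrow>
      sat (Vlevel \<beta>) (A \<beta> U) s (t \<beta> U) \<psi>"
      using e \<psi>(2) A[OF b a] by simp
  qed
qed

lemma decode_restr:
  assumes "limit_level \<beta>" "\<alpha> \<in> elts \<beta>" "limit_level \<alpha>"
  shows "decode j m (\<lambda>_. {}) (Vlevel \<alpha>) (restr \<alpha> U) i = decode j m (\<lambda>_. {}) (Vlevel \<beta>) U i \<inter> Vlevel \<alpha>"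
  using slice_restr[OF assms] unfolding decode_def restr_def by auto

lemma sentence_game:
  assumes "Pi1 m \<phi>" "sentence \<phi>"
  shows "\<exists>j \<psi>. first_order \<psi> \<and> free1 \<psi> = {} \<and>
     (\<forall>(\<beta>::'v::zfc_universe) A U. limit_level \<beta> \<longrightarrow>
        (models (Vlevel \<beta>) A \<phi> \<longleftrightarrow>
         game True m (Vlevel \<beta>) (\<lambda>U. sat (Vlevel \<beta>) A (\<lambda>_. undefined) (decode j m (\<lambda>_. {}) (Vlevel \<beta>) U) \<psi>) U))"
proof -
  have "prenex True m \<phi>" using assms(1) by (simp add: prenex_def)
  from prenex_game[OF this, where 'v = 'v] obtain j \<psi> where 1: "first_order \<psi>" "free1 \<psi> = free1 \<phi>"
    "\<And>(\<beta>::'v) A s t U. limit_level \<beta> \<Longrightarrow>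
        (sat (Vlevel \<beta>) A s t \<phi> \<longleftrightarrow>
         game True m (Vlevel \<beta>) (\<lambda>U. sat (Vlevel \<beta>) A s (decode j m t (Vlevel \<beta>) U) \<psi>) U)" by blast
  show ?thesis
  proof (intro exI conjI allI impI)
    show "first_order \<psi>" by (rule 1)
    show "free1 \<psi> = {}" using 1 assms(2) by (simp add: sentence_def)
    fix \<beta> :: 'v and A U assume b: "limit_level \<beta>"
    show "models (Vlevel \<beta>) A \<phi> \<longleftrightarrow>
         game True m (Vlevel \<beta>) (\<lambda>U. sat (Vlevel \<beta>) A (\<lambda>_. undefined) (decode j m (\<lambda>_. {}) (Vlevel \<beta>) U) \<psi>) U"
      unfolding models_sentence[OF assms(2), of _ _ "\<lambda>_. undefined" "\<lambda>_. {}"] by (rule 1(3)[OF b])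
  qed
qed

text \<open>By \<open>sentence_game\<close> the sentence is a game of length m with a first-order
  condition, and first-order conditions are reflective.\<close>

lemma large_models:
  assumes d: "limit_level \<delta>" and \<phi>: "Pi1 m \<phi>" "sentence \<phi>" "models (Vlevel \<delta>) (A \<inter> Vlevel \<delta>) \<phi>"
  shows "large m \<delta> {\<beta>. models (Vlevel \<beta>) (A \<inter> Vlevel \<beta>) \<phi>}"
proof -
  from sentence_game[OF \<phi>(1,2), where 'v = 'a] obtain j \<psi> where 1: "first_order \<psi>" "free1 \<psi> = {}"
    "\<And>(\<beta>::'a) A U. limit_level \<beta> \<Longrightarrow> models (Vlevel \<beta>) A \<phi> \<longleftrightarrow>
         game True m (Vlevel \<beta>) (\<lambda>U. sat (Vlevel \<beta>) A (\<lambda>_. undefined) (decode j m (\<lambda>_. {}) (Vlevel \<beta>) U) \<psi>) U"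
    by blast
  let ?R = "\<lambda>\<beta> U. sat (Vlevel \<beta>) (A \<inter> Vlevel \<beta>) (\<lambda>_. undefined) (decode j m (\<lambda>_. {}) (Vlevel \<beta>) U) \<psi>"
  show ?thesis unfolding large_def
  proof (intro exI[of _ ?R] conjI ballI impI)
    show "reflective ?R"
    proof (rule reflective_sat[OF 1(1,2)])
      fix \<alpha> \<beta> :: 'a assume "limit_level \<beta>" "\<alpha> \<in> elts \<beta>"
      then have "Vlevel \<alpha> \<subseteq> Vlevel \<beta>" using Vlevel_mono limit_level_ordinal by auto
      then show "A \<inter> Vlevel \<alpha> = A \<inter> Vlevel \<beta> \<inter> Vlevel \<alpha>" by auto
    qed (rule decode_restr)
    show "game True m (Vlevel \<delta>) (?R \<delta>) (\<lambda>_. {})" using \<phi>(3) 1(3)[OF d] by simp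
    fix \<beta> assume "good \<beta> \<and> game True m (Vlevel \<beta>) (?R \<beta>) (\<lambda>_. {})"
    then show "\<beta> \<in> {\<beta>. models (Vlevel \<beta>) (A \<inter> Vlevel \<beta>) \<phi>}" using 1(3)[OF good_limit_level[of \<beta>], of "A \<inter> Vlevel \<beta>" "\<lambda>_. {}"] by simp
  qed
qed

text \<open>Truth at V_\<alpha> for \<alpha> < \<beta> does not depend on \<beta>, however complex
  \<phi> is. A witness \<alpha> persists to every smaller limit level that contains it, and the
  absence of witnesses is inherited downwards.\<close>

lemma reflective_bex_models:
  "reflective (\<lambda>\<beta> U. \<exists>\<alpha>\<in>X \<inter> elts \<beta>. models (Vlevel \<alpha>) (U k \<inter> Vlevel \<alpha>) \<phi>)"
  unfolding reflective_def
proof (intro allI impI, elim conjE)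
  fix \<beta> :: 'a and U :: "nat \<Rightarrow> 'a set"
  assume b: "limit_level \<beta>"
  note ob = limit_level_ordinal[OF b]
  have c: "restr \<beta>' U k \<inter> Vlevel \<alpha> = U k \<inter> Vlevel \<alpha>" if "\<alpha> \<in> elts \<beta>'" "limit_level \<beta>'" for \<alpha> \<beta>'
    using Vlevel_mono[OF limit_level_ordinal[OF that(2)] that(1)] unfolding restr_def by auto
  show "eventually_below \<beta> (\<lambda>\<beta>'. (\<exists>\<alpha>\<in>X \<inter> elts \<beta>'. models (Vlevel \<alpha>) (restr \<beta>' U k \<inter> Vlevel \<alpha>) \<phi>) \<longleftrightarrow>
      (\<exists>\<alpha>\<in>X \<inter> elts \<beta>. models (Vlevel \<alpha>) (U k \<inter> Vlevel \<alpha>) \<phi>))"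
  proof (cases "\<exists>\<alpha>\<in>X \<inter> elts \<beta>. models (Vlevel \<alpha>) (U k \<inter> Vlevel \<alpha>) \<phi>")
    case True
    then obtain \<alpha> where a: "\<alpha> \<in> X" "\<alpha> \<in> elts \<beta>" "models (Vlevel \<alpha>) (U k \<inter> Vlevel \<alpha>) \<phi>" by auto
    have oa: "ordinal \<alpha>" using ordinal_mem[OF ob a(2)] .
    have aV: "\<alpha> \<in> Vlevel \<beta>" using ordinal_subset_Vlevel[OF ob] a(2) by auto
    show ?thesis
    proof (rule eventually_below_mono[OF eventually_below_mem[OF aV]])
      fix \<beta>' assume b': "\<beta>' \<in> elts \<beta>" "limit_level \<beta>'" "\<alpha> \<in> Vlevel \<beta>'"
      have "\<alpha> \<in> elts \<beta>'" using b'(3) ordinal_in_Vlevel_iff[OF oa limit_level_ordinal[OF b'(2)]] by simp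
      then have "\<exists>\<alpha>\<in>X \<inter> elts \<beta>'. models (Vlevel \<alpha>) (restr \<beta>' U k \<inter> Vlevel \<alpha>) \<phi>"
        using a c[OF _ b'(2)] by auto
      then show "(\<exists>\<alpha>\<in>X \<inter> elts \<beta>'. models (Vlevel \<alpha>) (restr \<beta>' U k \<inter> Vlevel \<alpha>) \<phi>) \<longleftrightarrow>
          (\<exists>\<alpha>\<in>X \<inter> elts \<beta>. models (Vlevel \<alpha>) (U k \<inter> Vlevel \<alpha>) \<phi>)"
        using True by blast
    qed
  next
    case False
    have "\<not> (\<exists>\<alpha>\<in>X \<inter> elts \<beta>'. models (Vlevel \<alpha>) (restr \<beta>' U k \<inter> Vlevel \<alpha>) \<phi>)"
      if b': "\<beta>' \<in> elts \<beta>" "limit_level \<beta>'" for \<beta>'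
      using False c[OF _ b'(2)] ordinal_trans[OF ob _ b'(1)] by auto
    then show ?thesis using False by (intro eventually_below_all) blast
  qed
qed

text \<open>Indescribability of the trace of \<open>X\<close> on \<beta> for one fixed sentence;
  that \<beta> is a cardinal is left to \<open>good_cardinal\<close>.\<close>

definition reflects_in :: "'v::zfc_universe set \<Rightarrow> fm \<Rightarrow> 'v \<Rightarrow> bool" where
  "reflects_in X \<phi> \<beta> \<longleftrightarrow> (\<forall>A. A \<subseteq> Vlevel \<beta> \<longrightarrow> models (Vlevel \<beta>) A \<phi> \<longrightarrow>
     (\<exists>\<alpha>\<in>X \<inter> elts \<beta>. models (Vlevel \<alpha>) (A \<inter> Vlevel \<alpha>) \<phi>))"

text \<open>The predicate A is the opening move. Failure of \<phi> is a game of length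
  \<open>k\<close> that starts with an existential move, so the two together have length
  \<open>Suc k\<close>; the existence of a reflecting \<alpha> goes into the winning
  condition.\<close>

lemma large_reflects_in:
  assumes d: "limit_level \<delta>" and \<phi>: "Pi1 k \<phi>" "sentence \<phi>" and r: "reflects_in X \<phi> \<delta>"
  shows "large (Suc k) \<delta> {\<beta>. reflects_in X \<phi> \<beta>}"
proof -
  from sentence_game[OF \<phi>(1,2), where 'v = 'a] obtain j \<psi> where 1: "first_order \<psi>" "free1 \<psi> = {}"
    "\<And>(\<beta>::'a) A U. limit_level \<beta> \<Longrightarrow> models (Vlevel \<beta>) A \<phi> \<longleftrightarrow>
         game True k (Vlevel \<beta>) (\<lambda>U. sat (Vlevel \<beta>) A (\<lambda>_. undefined) (decode j k (\<lambda>_. {}) (Vlevel \<beta>) U) \<psi>) U"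
    by blast
  let ?P = "\<lambda>\<beta> A U. sat (Vlevel \<beta>) A (\<lambda>_. undefined) (decode j k (\<lambda>_. {}) (Vlevel \<beta>) U) \<psi>"
  let ?Q = "\<lambda>\<beta> A. \<exists>\<alpha>\<in>X \<inter> elts \<beta>. models (Vlevel \<alpha>) (A \<inter> Vlevel \<alpha>) \<phi>"
  let ?R = "\<lambda>\<beta> U. \<not> ?P \<beta> (U k) U \<or> ?Q \<beta> (U k)"
  have eq: "game True (Suc k) (Vlevel \<beta>) (?R \<beta>) (\<lambda>_. {}) \<longleftrightarrow> reflects_in X \<phi> \<beta>" if b: "limit_level \<beta>" for \<beta>
  proof -
    have "game False k (Vlevel \<beta>) (?R \<beta>) ((\<lambda>_. {})(k := B)) \<longleftrightarrow>
        (models (Vlevel \<beta>) B \<phi> \<longrightarrow> ?Q \<beta> B)" for B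
    proof -
      have "game False k (Vlevel \<beta>) (?R \<beta>) ((\<lambda>_. {})(k := B)) \<longleftrightarrow>
          game False k (Vlevel \<beta>) (\<lambda>U. \<not> ?P \<beta> B U \<or> ?Q \<beta> B) ((\<lambda>_. {})(k := B))"
      proof (rule game_cong)
        fix U' :: "nat \<Rightarrow> 'a set"
        assume "\<And>i. i \<ge> k \<Longrightarrow> U' i = ((\<lambda>_. {})(k := B)) i"
        from this[of k] have "U' k = B" by simp
        then show "?R \<beta> U' \<longleftrightarrow> \<not> ?P \<beta> B U' \<or> ?Q \<beta> B" by simp
      qed
      also have "\<dots> \<longleftrightarrow> (models (Vlevel \<beta>) B \<phi> \<longrightarrow> ?Q \<beta> B)"
      proof (cases "?Q \<beta> B")
        case True
        then show ?thesis by (simp only: game_const simp_thms)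
      next
        case False
        have "game False k (Vlevel \<beta>) (\<lambda>U. \<not> ?P \<beta> B U) ((\<lambda>_. {})(k := B)) \<longleftrightarrow> \<not> models (Vlevel \<beta>) B \<phi>"
          unfolding 1(3)[OF b, of B "(\<lambda>_. {})(k := B)"] game_Not[of True] by simp
        then show ?thesis using False by (simp only: simp_thms) 
      qed
      finally show ?thesis .
    qed
    then show ?thesis unfolding reflects_in_def by simp
  qed
  have R: "reflective ?R"
  proof (intro reflective_disj reflective_Not reflective_bex_models reflective_sat 1)
    show "restr \<alpha> U k = U k \<inter> Vlevel \<alpha>" for \<alpha> U by (simp add: restr_def)
  qed (rule decode_restr)
  show ?thesis unfolding large_def
  proof (intro exI[of _ ?R] conjI ballI impI R)
    show "game True (Suc k) (Vlevel \<delta>) (?R \<delta>) (\<lambda>_. {})" unfolding eq[OF d] by (rule r)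
    fix \<beta> assume b: "good \<beta> \<and> game True (Suc k) (Vlevel \<beta>) (?R \<beta>) (\<lambda>_. {})"
    from conjunct2[OF this, unfolded eq[OF good_limit_level[OF conjunct1[OF b]]]]
    show "\<beta> \<in> {\<beta>. reflects_in X \<phi> \<beta>}" by simp
  qed
qed

text \<open>A closure point \<gamma> of the bijection whose level contains \<alpha> also contains
  the preimage of \<gamma>, and hence would contain \<gamma> itself.\<close>

lemma good_cardinal:
  assumes b: "good \<beta>"
  shows "cardinal \<beta>"
  unfolding cardinal_def
proof (intro conjI ballI notI)
  note l = good_limit_level[OF b]
  note ob = limit_level_ordinal[OF l]
  show "ordinal \<beta>" by (rule ob)
  fix \<alpha> assume a: "\<alpha> \<in> elts \<beta>" and "elts \<alpha> \<approx> elts \<beta>"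
  then obtain f where f: "bij_betw f (elts \<alpha>) (elts \<beta>)" unfolding eqpoll_def by auto
  have sub: "elts \<beta> \<subseteq> Vlevel \<beta>" by (rule ordinal_subset_Vlevel[OF ob])
  have fb: "f x \<in> elts \<beta>" if "x \<in> elts \<alpha>" for x using f that unfolding bij_betw_def by auto
  have e: "eventually_below \<beta> (closed_under (\<lambda>x. if x \<in> elts \<alpha> then f x else x))"
    by (rule eventually_belowI[of _ "\<lambda>x. if x \<in> elts \<alpha> then f x else x"]) (use fb sub in \<open>auto simp: closed_under_def\<close>)
  have "\<alpha> \<in> Vlevel \<beta>" using a sub by auto
  from goodD[OF b eventually_below_conj[OF l eventually_below_mem[OF this] e]]
  obtain \<gamma> where g: "\<gamma> \<in> elts \<beta>" "limit_level \<gamma>" "\<alpha> \<in> Vlevel \<gamma>"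
    "closed_under (\<lambda>x. if x \<in> elts \<alpha> then f x else x) \<gamma>" by auto
  obtain x where x: "x \<in> elts \<alpha>" "\<gamma> = f x" using f g(1) unfolding bij_betw_def by auto
  have "x \<in> Vlevel \<gamma>" using Vlevel_trans[OF limit_level_ordinal[OF g(2)] g(3) x(1)] .
  then have "f x \<in> Vlevel \<gamma>" using g(4) x(1) unfolding closed_under_def by auto
  then show False using ordinal_notin_Vlevel[OF limit_level_ordinal[OF g(2)]] x(2) by simp
qed

text \<open>For each single sentence reflection is a game of length \<open>Suc k\<close>;
  \<open>fm\<close> is countable, so countable completeness collects all sentences. Goodness of
  \<beta> supplies that it is a cardinal.\<close>

lemma large_indescribable_subset:
  assumes X: "indescribable_subset k \<delta> X"
  shows "large (Suc k) \<delta> {\<beta>. indescribable_subset k \<beta> (X \<inter> elts \<beta>)}"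
proof -
  note l = indescribable_subset_limit_level[OF X]
  have Xd: "X \<inter> elts \<delta> = X" using indescribable_subset_subset[OF X] by auto
  define T where "T i = {\<beta>. Pi1 k (from_nat i) \<and> sentence (from_nat i) \<longrightarrow> reflects_in X (from_nat i) \<beta>}" for i
  have "large (Suc k) \<delta> (T i)" for i
  proof (cases "Pi1 k (from_nat i) \<and> sentence (from_nat i)")
    case True
    then have "reflects_in X (from_nat i) \<delta>"
      using X unfolding reflects_in_def Xd indescribable_subset_def by auto
    then show ?thesis using large_reflects_in[OF l] True unfolding T_def by auto
  next
    case False
    then have "T i = UNIV" unfolding T_def by auto
    then show ?thesis using large_UNIV by simp
  qed
  from large_INT[OF l this] show ?thesis
  proof (rule large_mono)
    fix \<beta> assume b: "good \<beta>" "\<beta> \<in> (\<Inter>i. T i)"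
    have "reflects_in X \<phi> \<beta>" if "Pi1 k \<phi>" "sentence \<phi>" for \<phi>
    proof -
      have "\<beta> \<in> T (to_nat \<phi>)" using b(2) by auto
      then show ?thesis using that unfolding T_def by simp
    qed
    then show "\<beta> \<in> {\<beta>. indescribable_subset k \<beta> (X \<inter> elts \<beta>)}"
      using good_cardinal[OF b(1)] unfolding indescribable_subset_def reflects_in_def by auto
  qed
qed

subsection \<open>Two sets that do not reflect simultaneously\<close>

lemma large_mem:
  assumes d: "limit_level \<delta>" and a: "\<alpha> \<in> elts \<delta>"
  shows "large m \<delta> {\<beta>. \<alpha> \<in> elts \<beta>}"
proof -
  have oa: "ordinal \<alpha>" using ordinal_mem[OF limit_level_ordinal[OF d] a] .
  have "eventually_below \<beta> (\<lambda>\<gamma>. \<alpha> \<in> elts \<gamma> \<longleftrightarrow> \<alpha> \<in> elts \<beta>)" if b: "limit_level \<beta>" for \<beta>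
  proof (cases "\<alpha> \<in> elts \<beta>")
    case True
    then have "\<alpha> \<in> Vlevel \<beta>" using ordinal_subset_Vlevel[OF limit_level_ordinal[OF b]] by auto
    from eventually_below_mem[OF this] show ?thesis
      by (rule eventually_below_mono) (use True ordinal_in_Vlevel_iff[OF oa limit_level_ordinal] in auto)
  next
    case False
    then show ?thesis using ordinal_trans[OF limit_level_ordinal[OF b]] by (intro eventually_below_all) auto
  qed
  then have "reflective (\<lambda>\<beta> _. \<alpha> \<in> elts \<beta>)" unfolding reflective_def by auto
  then show ?thesis
    unfolding large_def by (intro exI[of _ "\<lambda>\<beta> _. \<alpha> \<in> elts \<beta>"]) (simp add: game_const a)
qed

text \<open>The sentence that witnesses the failure of indescribability holds at \<kappa> and fails
  at every member of \<open>S\<close>.\<close>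

lemma large_Compl:
  assumes "limit_level \<kappa>" "cardinal \<kappa>" "S \<subseteq> elts \<kappa>" "\<not> indescribable_subset m \<kappa> S"
  shows "large m \<kappa> (- S)"
proof -
  obtain A \<phi> where A: "A \<subseteq> Vlevel \<kappa>" "Pi1 m \<phi>" "sentence \<phi>" "models (Vlevel \<kappa>) A \<phi>"
    "\<forall>\<alpha>\<in>S. \<not> models (Vlevel \<alpha>) (A \<inter> Vlevel \<alpha>) \<phi>"
    using assms unfolding indescribable_subset_def by blast
  have "models (Vlevel \<kappa>) (A \<inter> Vlevel \<kappa>) \<phi>" using A by (simp add: Int_absorb2)
  from large_models[OF assms(1) A(2,3) this] show ?thesis
    by (rule large_mono) (use A(5) in auto)
qed

lemma indescribable_subset_mono:
  "indescribable_subset m \<kappa> S \<Longrightarrow> S \<subseteq> S' \<Longrightarrow> S' \<subseteq> elts \<kappa> \<Longrightarrow> indescribable_subset m \<kappa> S'"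
  unfolding indescribable_subset_def by blast

text \<open>Two reflections in a row: \<phi>, read as a Pi^1_(k+1) sentence, descends from \<kappa>
  to some \<beta> in \<open>Z\<close>, and from there into \<open>D\<close>, since the trace of
  \<open>D\<close> on \<beta> is indescribable.\<close>

lemma indescribable_subset_of_large:
  assumes \<kappa>: "indescribable_subset (Suc k) \<kappa> (elts \<kappa>)"
    and Z: "large (Suc k) \<kappa> Z" and D: "D \<subseteq> elts \<kappa>"
    and DZ: "\<And>\<beta>. \<beta> \<in> elts \<kappa> \<Longrightarrow> \<beta> \<in> Z \<Longrightarrow> indescribable_subset k \<beta> (D \<inter> elts \<beta>)"
  shows "indescribable_subset k \<kappa> D"
  unfolding indescribable_subset_def
proof (intro conjI allI impI, goal_cases)
  case 1
  show ?case using \<kappa> unfolding indescribable_subset_def by auto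
next
  case 2
  show ?case by (rule D)
next
  case (3 A \<phi>)
  note l = indescribable_subset_limit_level[OF \<kappa>]
  have "models (Vlevel \<kappa>) (A \<inter> Vlevel \<kappa>) \<phi>" using 3 by (simp add: Int_absorb2)
  then have "large (Suc k) \<kappa> {\<beta>. models (Vlevel \<beta>) (A \<inter> Vlevel \<beta>) \<phi>}"
    using large_models[OF l] 3 Pi1_Sigma1_mono(1) by blast
  from large_meets[OF \<kappa> large_Int[OF l Z this]]
  obtain \<beta> where b: "\<beta> \<in> elts \<kappa>" "\<beta> \<in> Z" "models (Vlevel \<beta>) (A \<inter> Vlevel \<beta>) \<phi>" by auto
  have "A \<inter> Vlevel \<beta> \<subseteq> Vlevel \<beta>" by auto
  then obtain \<alpha> where a: "\<alpha> \<in> D \<inter> elts \<beta>" "models (Vlevel \<alpha>) (A \<inter> Vlevel \<beta> \<inter> Vlevel \<alpha>) \<phi>"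
    using DZ[OF b(1,2)] b(3) 3 unfolding indescribable_subset_def by blast
  have "ordinal \<beta>" using ordinal_mem[OF limit_level_ordinal[OF l] b(1)] .
  then have "Vlevel \<alpha> \<subseteq> Vlevel \<beta>" using Vlevel_mono a(1) by auto
  then have "A \<inter> Vlevel \<beta> \<inter> Vlevel \<alpha> = A \<inter> Vlevel \<alpha>" by auto
  then show ?case using a by auto
qed

theorem theorem7p1:
  fixes \<kappa> :: "'v::zfc_universe" and n :: nat
  assumes "1 \<le> n"
    and "indescribable n \<kappa>"
    and "square n \<kappa>"
  shows "\<exists>S0 S1. S0 \<subseteq> elts \<kappa> \<and> S1 \<subseteq> elts \<kappa> \<and>
           indescribable_subset n \<kappa> S0 \<and> indescribable_subset n \<kappa> S1 \<and>
           \<not> (\<exists>\<beta>\<in>elts \<kappa>. indescribable_subset n \<beta> (S0 \<inter> elts \<beta>) \<and>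
                         indescribable_subset n \<beta> (S1 \<inter> elts \<beta>))"
proof -
  obtain k where n: "n = Suc k" using assms(1) by (cases n) auto
  have \<kappa>: "indescribable_subset (Suc k) \<kappa> (elts \<kappa>)" using assms(2) unfolding n indescribable_def .
  note l = indescribable_subset_limit_level[OF \<kappa>]
  note ok = limit_level_ordinal[OF l]
  define I where "I = Tr k \<kappa> (elts \<kappa>)"
  have I: "\<beta> \<in> I \<longleftrightarrow> \<beta> \<in> elts \<kappa> \<and> indescribable_subset k \<beta> (elts \<beta>)" for \<beta>
  proof -
    have "\<beta> \<in> elts \<kappa> \<Longrightarrow> elts \<kappa> \<inter> elts \<beta> = elts \<beta>" using ordinal_trans[OF ok] by auto
    then show ?thesis unfolding I_def Tr_def by auto
  qed
  from assms(3) obtain C where club: "\<And>\<alpha>. \<alpha> \<in> I \<Longrightarrow> n_club (Suc k) \<alpha> (C \<alpha>)"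
    and coh: "\<And>\<alpha> \<beta>. \<alpha> \<in> I \<Longrightarrow> \<beta> \<in> I \<Longrightarrow> \<alpha> \<in> elts \<beta> \<Longrightarrow> indescribable_subset k \<alpha> (C \<beta> \<inter> elts \<alpha>) \<Longrightarrow>
       C \<alpha> = C \<beta> \<inter> elts \<alpha>"
    and nothread: "\<not> (\<exists>D. is_thread (Suc k) \<kappa> C D)"
    unfolding square_def n diff_Suc_1 I_def by blast
  have Csub: "C \<beta> \<subseteq> elts \<beta>" if "\<beta> \<in> I" for \<beta>
    using club[OF that] unfolding n_club_def n_closed_def by auto
  \<comment> \<open>By monotonicity a set that is indescribable at \<alpha> makes \<alpha> itself
    indescribable, so C is constrained at \<alpha>.\<close>
  have II: "\<alpha> \<in> I" if "\<alpha> \<in> elts \<kappa>" "indescribable_subset k \<alpha> X" for \<alpha> X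
    using that indescribable_subset_mono[OF that(2) indescribable_subset_subset[OF that(2)]] I by auto
  define P where "P \<gamma> b = {\<beta> \<in> I. (\<gamma> \<in> C \<beta>) = b}" for \<gamma> b
  have Pk: "P \<gamma> b \<subseteq> elts \<kappa>" for \<gamma> b unfolding P_def using I by auto
  have "\<exists>\<gamma>\<in>elts \<kappa>. \<forall>b. indescribable_subset (Suc k) \<kappa> (P \<gamma> b)"
  proof (rule ccontr)
    assume no: "\<not> ?thesis"
    have card: "cardinal \<kappa>" using \<kappa> unfolding indescribable_subset_def by auto
    have one: "\<exists>b. large (Suc k) \<kappa> (- P \<gamma> b)" if "\<gamma> \<in> elts \<kappa>" for \<gamma>
    proof -
      obtain b where "\<not> indescribable_subset (Suc k) \<kappa> (P \<gamma> b)" using no \<open>\<gamma> \<in> elts \<kappa>\<close> by auto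
      from large_Compl[OF l card Pk this] show ?thesis by auto
    qed
    \<comment> \<open>\<gamma> is put into D if almost every \<beta> in I has \<gamma> in
      \<open>C \<beta>\<close>. If not, then by \<open>one\<close> almost every \<beta> in I has
      \<gamma> outside \<open>C \<beta>\<close>.\<close>
    define D where "D = {\<gamma> \<in> elts \<kappa>. large (Suc k) \<kappa> (- P \<gamma> False)}"
    \<comment> \<open>For \<beta> in I, membership in \<open>T \<gamma>\<close> says that
      \<open>C \<beta>\<close> and D agree about \<gamma>. The diagonal intersection is indexed by
      all elements of a level, and \<open>UNIV\<close> disposes of those that are not ordinals below
      \<kappa>.\<close>
    define T where "T \<gamma> = (if \<gamma> \<in> elts \<kappa> then - P \<gamma> (\<gamma> \<notin> D) else UNIV)" for \<gamma>
    have "large (Suc k) \<kappa> (T \<gamma>)" for \<gamma>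
    proof (cases "\<gamma> \<in> elts \<kappa>")
      case True
      then obtain b where b: "large (Suc k) \<kappa> (- P \<gamma> b)" using one by auto
      show ?thesis
        using b True unfolding T_def D_def by (cases b; cases "large (Suc k) \<kappa> (- P \<gamma> False)") auto
    qed (simp add: T_def large_UNIV)
    note diag = large_diag[where T = T, OF l this]
    have ik: "indescribable_subset k \<kappa> (elts \<kappa>)" by (rule indescribable_subset_Suc[OF \<kappa>])
    have "large (Suc k) \<kappa> I"
      by (rule large_mono[OF large_indescribable_subset[OF ik]]) (simp add: I_def Tr_def)
    from large_Int[OF l diag this]
    have Z: "large (Suc k) \<kappa> {\<beta> \<in> I. C \<beta> = D \<inter> elts \<beta>}"
    proof (rule large_mono)
      fix \<beta> assume b: "\<beta> \<in> elts \<kappa>" "\<beta> \<in> {\<beta>. \<forall>\<gamma>\<in>Vlevel \<beta>. \<beta> \<in> T \<gamma>} \<inter> I"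
      have "\<gamma> \<in> C \<beta> \<longleftrightarrow> \<gamma> \<in> D" if g: "\<gamma> \<in> elts \<beta>" for \<gamma>
      proof -
        have "\<gamma> \<in> elts \<kappa>" using ordinal_trans[OF ok g b(1)] .
        moreover have "\<gamma> \<in> Vlevel \<beta>" using ordinal_subset_Vlevel[OF ordinal_mem[OF ok b(1)]] g by auto
        ultimately have "\<beta> \<notin> P \<gamma> (\<gamma> \<notin> D)" using b(2) unfolding T_def by auto
        then show ?thesis using b(2) unfolding P_def by auto
      qed
      then show "\<beta> \<in> {\<beta> \<in> I. C \<beta> = D \<inter> elts \<beta>}" using b(2) Csub by auto
    qed
    have Dk: "D \<subseteq> elts \<kappa>" unfolding D_def by auto
    have "indescribable_subset k \<kappa> D"
    proof (rule indescribable_subset_of_large[OF \<kappa> Z Dk])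
      fix \<beta> assume "\<beta> \<in> {\<beta> \<in> I. C \<beta> = D \<inter> elts \<beta>}"
      then show "indescribable_subset k \<beta> (D \<inter> elts \<beta>)" using club[of \<beta>] unfolding n_club_def by simp
    qed
    moreover have thread: "\<alpha> \<in> D \<and> C \<alpha> = D \<inter> elts \<alpha>"
      if a: "\<alpha> \<in> elts \<kappa>" "indescribable_subset k \<alpha> (D \<inter> elts \<alpha>)" for \<alpha>
    proof -
      \<comment> \<open>A single \<beta> above \<alpha> at which \<open>C \<beta>\<close> is the
        trace of D gives both requirements: closure of \<open>C \<beta>\<close> puts \<alpha> into
        D, and coherence identifies \<open>C \<alpha>\<close>.\<close>
      from large_meets[OF \<kappa> large_Int[OF l Z large_mem[OF l a(1)]]]
      obtain \<beta> where b: "\<beta> \<in> I" "C \<beta> = D \<inter> elts \<beta>" "\<alpha> \<in> elts \<beta>" by auto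
      have "ordinal \<beta>" using b(1) I ordinal_mem[OF ok] by auto
      then have "elts \<alpha> \<subseteq> elts \<beta>" using ordinal_trans b(3) by blast
      then have eq: "C \<beta> \<inter> elts \<alpha> = D \<inter> elts \<alpha>" using b(2) by auto
      have "\<alpha> \<in> C \<beta>"
        using club[OF b(1)] a(2) b(3) eq unfolding n_club_def n_closed_def by simp
      moreover have "C \<alpha> = C \<beta> \<inter> elts \<alpha>"
        using coh[OF II[OF a] b(1,3)] a(2) eq by simp
      ultimately show ?thesis using eq b(2) by auto
    qed
    ultimately have "is_thread (Suc k) \<kappa> C D"
      unfolding is_thread_def n_club_def n_closed_def diff_Suc_1 using Dk by (auto simp: Tr_def)
    then show False using nothread by auto
  qed
  then obtain \<gamma> where g: "\<gamma> \<in> elts \<kappa>" "\<And>b. indescribable_subset (Suc k) \<kappa> (P \<gamma> b)" by auto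
  have "\<not> (\<forall>b. indescribable_subset (Suc k) \<delta> (P \<gamma> b \<inter> elts \<delta>))" if d: "\<delta> \<in> elts \<kappa>" for \<delta>
  proof
    assume r: "\<forall>b. indescribable_subset (Suc k) \<delta> (P \<gamma> b \<inter> elts \<delta>)"
    then have rb: "indescribable_subset (Suc k) \<delta> (P \<gamma> b \<inter> elts \<delta>)" for b by auto
    note ld = indescribable_subset_limit_level[OF rb[of True]]
    have dI: "\<delta> \<in> I" using II[OF d indescribable_subset_Suc[OF rb]] .
    have "indescribable_subset k \<delta> (C \<delta>)" using club[OF dI] unfolding n_club_def by simp
    note lC = large_indescribable_subset[OF this]
    have coh': "C \<beta> = C \<delta> \<inter> elts \<beta>"
      if "\<beta> \<in> P \<gamma> b \<inter> elts \<delta>" "indescribable_subset k \<beta> (C \<delta> \<inter> elts \<beta>)" for \<beta> b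
      using coh[of \<beta> \<delta>] that dI unfolding P_def by auto
    from large_meets[OF rb[of True] lC] obtain \<beta> where b: "\<beta> \<in> P \<gamma> True \<inter> elts \<delta>"
      "indescribable_subset k \<beta> (C \<delta> \<inter> elts \<beta>)" by auto
    have "\<gamma> \<in> C \<beta>" using b(1) unfolding P_def by auto
    then have gC: "\<gamma> \<in> C \<delta>" using coh'[OF b] by auto
    then have "\<gamma> \<in> elts \<delta>" using Csub[OF dI] by auto
    \<comment> \<open>Here \<gamma> < \<beta>' must be demanded, since otherwise \<gamma> would be
      missing from \<open>C \<beta>'\<close> for a trivial reason. For \<beta> it was automatic, as
      \<gamma> is in \<open>C \<beta>\<close>.\<close>
    from large_meets[OF rb[of False] large_Int[OF ld lC large_mem[OF ld this]]]
    obtain \<beta>' where b': "\<beta>' \<in> P \<gamma> False \<inter> elts \<delta>" "indescribable_subset k \<beta>' (C \<delta> \<inter> elts \<beta>')"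
      "\<gamma> \<in> elts \<beta>'" by auto
    have "\<gamma> \<in> C \<beta>'" using coh'[OF b'(1,2)] gC b'(3) by auto
    then show False using b'(1) unfolding P_def by auto
  qed
  then have "\<not> (\<exists>\<delta>\<in>elts \<kappa>. indescribable_subset (Suc k) \<delta> (P \<gamma> True \<inter> elts \<delta>) \<and>
      indescribable_subset (Suc k) \<delta> (P \<gamma> False \<inter> elts \<delta>))"
    by (auto simp: all_bool_eq)
  then show ?thesis
    unfolding n using g(2) Pk by (intro exI[of _ "P \<gamma> True"] exI[of _ "P \<gamma> False"] conjI)
qed

end
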